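(* Let $N=(N,\phi,\xi,\eta,g)$ be an almost contact metric manifold and $M=B\times_f\overline{F}$ a nontrivial warped product submanifold of $N$. Assume that $\xi$ is tangent to $M$ and $N$ is one of the following three manifolds: cosymplectic, Sasakian, Kenmotsu. Then there does not exist a proper pointwise semi-slant submanifold $M$ of $N$ such that $\mathcal{D}_1=T\overline{F}$ and $\mathcal{D}_2=TB$.
   Context: An almost contact metric manifold $(N,\phi,\xi,\eta,g)$ is a smooth manifold $N$ of dimension $2n+1$ with a tensor field $\phi$ of type $(1,1)$, a vector field $\xi$, a $1$-form $\eta$ and a Riemannian metric $g$ such that $\phi^2=-I+\eta\otimes\xi$, $\eta(\xi)=1$ and $g(\phi X,\phi Y)=g(X,Y)-\eta(X)\eta(Y)$ for all vector fields $X,Y$ (hence $\phi\xi=0$, $\eta\circ\phi=0$, $\eta(X)=g(X,\xi)$). With $\overline{\nabla}$ the Levi-Civita connection of $(N,g)$, the manifold is: cosymplectic iff $\overline{\nabla}\phi=0$; Sasakian iff $(\overline{\nabla}_X\phi)Y=g(X,Y)\xi-\eta(Y)X$; Kenmotsu iff $(\overline{\nabla}_X\phi)Y=g(\phi X,Y)\xi-\eta(Y)\phi X$, for all vector fields $X,Y$ on $N$. A submanifold $M$ of $N$ is a pointwise semi-slant submanifold if there is a distribution $\mathcal{D}_1\subset TM$ on $M$ such that $TM=\mathcal{D}_1\oplus\mathcal{D}_2$, $\phi(\mathcal{D}_1)\subset\mathcal{D}_1$, and at each given point $p\in M$ the angle $\theta=\theta(X)$ between $\phi X$ and the space $(\mathcal{D}_2)_p$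 is constant for nonzero $X\in(\mathcal{D}_2)_p$, where $\mathcal{D}_2$ is the orthogonal complement of $\mathcal{D}_1$ in $TM$. The angle $\theta$, as a function on $M$, is the semi-slant function; $M$ is proper if $\theta$ takes values in $(0,\frac{\pi}{2})$. (When $\xi$ is tangent to $M$, necessarily $\xi\in\Gamma(\mathcal{D}_1)$, since the angle for $X=\xi$ is not defined.) For Riemannian manifolds $(B,g_B)$, $(\overline{F},g_{\overline{F}})$ and a positive smooth function $f$ on $B$, the warped product manifold $B\times_f\overline{F}$ is the product manifold $B\times\overline{F}$ with the metric $g_B+f^2g_{\overline{F}}$ (pulled back via the projections); $f$ is the warping function, and the warped product is trivial if $f$ is constant. A warped product submanifold is a submanifold which, with the induced metric, is such a warped product. $TB$ and $T\overline{F}$ are identified with the corresponding subbundles of $TM$.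
   Formalization: The base B is assumed connected: otherwise f may be locally constant but not constant (B two copies of a slant plane in C²×R, f equal to 1 and 2), and the claim fails. B and F have positive dimension; the 0-dimensional cases are then vacuous. *)

theory Defs
  imports "HOL-Analysis.Analysis" "HOL-Library.Function_Algebras"
begin

text \<open>
  Smooth means C-infinity throughout. Manifolds are Hausdorff, second countable and without
  boundary; the underlying point set is a whole type, and the model space is a Euclidean space
  \<open>'e\<close>, so that the dimension is \<open>DIM('e)\<close>. Atlases are not required to be maximal.
\<close>

instantiation "fun" :: (type, real_vector) real_vector
begin

definition "scaleR r f = (\<lambda>x. r *\<^sub>R f x)"

instance
  by standard (auto simp: scaleR_fun_def fun_eq_iff algebra_simps)

end


section \<open>Smooth functions between open subsets of Euclidean spaces\<close>

text \<open>Only used for open sets.\<close>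

primrec Ck_on ::
  "nat \<Rightarrow> 'a::euclidean_space set \<Rightarrow> ('a \<Rightarrow> 'b::real_normed_vector) \<Rightarrow> bool" where
  "Ck_on 0 S f \<longleftrightarrow> continuous_on S f"
| "Ck_on (Suc k) S f \<longleftrightarrow>
     (\<forall>x\<in>S. f differentiable (at x)) \<and> (\<forall>v. Ck_on k S (\<lambda>x. frechet_derivative f (at x) v))"

definition smooth_on ::
  "'a::euclidean_space set \<Rightarrow> ('a \<Rightarrow> 'b::real_normed_vector) \<Rightarrow> bool" where
  "smooth_on S f \<longleftrightarrow> (\<forall>k. Ck_on k S f)"


section \<open>Smooth manifolds\<close>

type_synonym ('a, 'e) chart = "'a set \<times> ('a \<Rightarrow> 'e)"

abbreviation cdom :: "('a, 'e) chart \<Rightarrow> 'a set" where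
  "cdom \<equiv> fst"

abbreviation cmap :: "('a, 'e) chart \<Rightarrow> 'a \<Rightarrow> 'e" where
  "cmap \<equiv> snd"

abbreviation cinv :: "('a, 'e) chart \<Rightarrow> 'e \<Rightarrow> 'a" where
  "cinv c \<equiv> inv_into (cdom c) (cmap c)"

definition is_chart :: "('a::topological_space, 'e::euclidean_space) chart \<Rightarrow> bool" where
  "is_chart c \<longleftrightarrow> open (cdom c) \<and> open (cmap c ` cdom c) \<and>
     homeomorphism (cdom c) (cmap c ` cdom c) (cmap c) (cinv c)"

definition smooth_manifold ::
  "('a::{t2_space,second_countable_topology}, 'e::euclidean_space) chart set \<Rightarrow> bool" where
  "smooth_manifold A \<longleftrightarrow> (\<forall>c\<in>A. is_chart c) \<and> (\<Union>c\<in>A. cdom c) = UNIV \<and>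
     (\<forall>c\<in>A. \<forall>d\<in>A. smooth_on (cmap c ` (cdom c \<inter> cdom d)) (cmap d \<circ> cinv c))"

definition chart_at :: "('a, 'e) chart set \<Rightarrow> 'a \<Rightarrow> ('a, 'e) chart" where
  "chart_at A p = (SOME c. c \<in> A \<and> p \<in> cdom c)"

definition smooth_function ::
  "('a::topological_space, 'e::euclidean_space) chart set \<Rightarrow> ('a \<Rightarrow> real) \<Rightarrow> bool" where
  "smooth_function A h \<longleftrightarrow> (\<forall>c\<in>A. smooth_on (cmap c ` cdom c) (h \<circ> cinv c))"

definition smooth_map ::
  "('a::topological_space, 'e::euclidean_space) chart set \<Rightarrow>
   ('b::topological_space, 'k::euclidean_space) chart set \<Rightarrow> ('a \<Rightarrow> 'b) \<Rightarrow> bool" where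
  "smooth_map A A' h \<longleftrightarrow> continuous_on UNIV h \<and>
     (\<forall>c\<in>A. \<forall>d\<in>A'. smooth_on (cmap c ` (cdom c \<inter> h -` cdom d)) (cmap d \<circ> h \<circ> cinv c))"


section \<open>Tangent vectors\<close>

text \<open>
  A tangent vector at \<open>p\<close> is given by its components in each chart around \<open>p\<close>, subject to the
  usual transformation rule. It is set to 0 on all other indices, so that equality and the
  pointwise vector space operations are the intended ones.
\<close>

type_synonym ('a, 'e) tvec = "('a, 'e) chart \<Rightarrow> 'e"

definition tangent_space ::
  "('a, 'e::euclidean_space) chart set \<Rightarrow> 'a \<Rightarrow> ('a, 'e) tvec set" where
  "tangent_space A p = {v.
     (\<forall>c\<in>A. \<forall>d\<in>A. p \<in> cdom c \<inter> cdom d \<longrightarrow>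
        v d = frechet_derivative (cmap d \<circ> cinv c) (at (cmap c p)) (v c)) \<and>
     (\<forall>c. \<not> (c \<in> A \<and> p \<in> cdom c) \<longrightarrow> v c = 0)}"

text \<open>The tangent vector at \<open>p\<close> with components \<open>e\<close> in the chart \<open>c\<close>.\<close>

definition coord_vector ::
  "('a, 'e::euclidean_space) chart set \<Rightarrow> ('a, 'e) chart \<Rightarrow> 'a \<Rightarrow> 'e \<Rightarrow> ('a, 'e) tvec" where
  "coord_vector A c p e = (\<lambda>d. if d \<in> A \<and> p \<in> cdom d
     then frechet_derivative (cmap d \<circ> cinv c) (at (cmap c p)) e else 0)"

text \<open>By the chain rule, the chart chosen by \<open>chart_at\<close> in the next two definitions is irrelevant.\<close>

definition vec_apply ::
  "('a, 'e::euclidean_space) chart set \<Rightarrow> 'a \<Rightarrow> ('a, 'e) tvec \<Rightarrow> ('a \<Rightarrow> real) \<Rightarrow> real" where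
  "vec_apply A p v h = (let c = chart_at A p in
     frechet_derivative (h \<circ> cinv c) (at (cmap c p)) (v c))"

definition differential ::
  "('a, 'e::euclidean_space) chart set \<Rightarrow> ('b, 'k::euclidean_space) chart set \<Rightarrow>
   ('a \<Rightarrow> 'b) \<Rightarrow> 'a \<Rightarrow> ('a, 'e) tvec \<Rightarrow> ('b, 'k) tvec" where
  "differential A A' h p v = (\<lambda>d. if d \<in> A' \<and> h p \<in> cdom d
     then (let c = chart_at A p in
       frechet_derivative (cmap d \<circ> h \<circ> cinv c) (at (cmap c p)) (v c)) else 0)"


section \<open>Vector fields, distributions and tensor fields\<close>

type_synonym ('a, 'e) vfield = "'a \<Rightarrow> ('a, 'e) tvec"

definition smooth_vfield_on ::
  "('a::topological_space, 'e::euclidean_space) chart set \<Rightarrow> 'a set \<Rightarrow> ('a, 'e) vfield \<Rightarrow> bool" where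
  "smooth_vfield_on A U X \<longleftrightarrow> (\<forall>p\<in>U. X p \<in> tangent_space A p) \<and>
     (\<forall>c\<in>A. smooth_on (cmap c ` (cdom c \<inter> U)) (\<lambda>u. X (cinv c u) c))"

definition vfields ::
  "('a::topological_space, 'e::euclidean_space) chart set \<Rightarrow> ('a, 'e) vfield set" where
  "vfields A = {X. smooth_vfield_on A UNIV X}"

definition lie_bracket ::
  "('a, 'e::euclidean_space) chart set \<Rightarrow> ('a, 'e) vfield \<Rightarrow> ('a, 'e) vfield \<Rightarrow> ('a, 'e) vfield" where
  "lie_bracket A X Y p = (\<lambda>c. if c \<in> A \<and> p \<in> cdom c
     then frechet_derivative (\<lambda>u. Y (cinv c u) c) (at (cmap c p)) (X p c)
        - frechet_derivative (\<lambda>u. X (cinv c u) c) (at (cmap c p)) (Y p c)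
     else 0)"

text \<open>A distribution is a smooth subbundle of the tangent bundle: it is locally spanned by a
  smooth frame \<open>E 0, \<dots>, E (k - 1)\<close>.\<close>

definition distribution ::
  "('a::topological_space, 'e::euclidean_space) chart set \<Rightarrow> ('a \<Rightarrow> ('a, 'e) tvec set) \<Rightarrow> bool" where
  "distribution A D \<longleftrightarrow> (\<exists>k::nat. \<forall>p. \<exists>U E. open U \<and> p \<in> U \<and>
     (\<forall>i<k. smooth_vfield_on A U (E i)) \<and>
     (\<forall>q\<in>U. inj_on (\<lambda>i. E i q) {..<k} \<and> independent ((\<lambda>i. E i q) ` {..<k}) \<and>
            span ((\<lambda>i. E i q) ` {..<k}) = D q))"

definition one_form ::
  "('a::topological_space, 'e::euclidean_space) chart set \<Rightarrow>
   ('a \<Rightarrow> ('a, 'e) tvec \<Rightarrow> real) \<Rightarrow> bool" where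
  "one_form A \<eta> \<longleftrightarrow>
     (\<forall>p. \<forall>v\<in>tangent_space A p. \<forall>w\<in>tangent_space A p. \<forall>a b.
        \<eta> p (a *\<^sub>R v + b *\<^sub>R w) = a * \<eta> p v + b * \<eta> p w) \<and>
     (\<forall>c\<in>A. \<forall>e. smooth_on (cmap c ` cdom c)
        (\<lambda>u. \<eta> (cinv c u) (coord_vector A c (cinv c u) e)))"

text \<open>Tensor fields of type (1,1).\<close>

definition endo_field ::
  "('a::topological_space, 'e::euclidean_space) chart set \<Rightarrow>
   ('a \<Rightarrow> ('a, 'e) tvec \<Rightarrow> ('a, 'e) tvec) \<Rightarrow> bool" where
  "endo_field A \<phi> \<longleftrightarrow>
     (\<forall>p. \<forall>v\<in>tangent_space A p. \<phi> p v \<in> tangent_space A p) \<and>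
     (\<forall>p. \<forall>v\<in>tangent_space A p. \<forall>w\<in>tangent_space A p. \<forall>a b.
        \<phi> p (a *\<^sub>R v + b *\<^sub>R w) = a *\<^sub>R \<phi> p v + b *\<^sub>R \<phi> p w) \<and>
     (\<forall>c\<in>A. \<forall>e. smooth_on (cmap c ` cdom c)
        (\<lambda>u. \<phi> (cinv c u) (coord_vector A c (cinv c u) e) c))"

type_synonym ('a, 'e) metric = "'a \<Rightarrow> ('a, 'e) tvec \<Rightarrow> ('a, 'e) tvec \<Rightarrow> real"

definition riemannian_metric ::
  "('a::topological_space, 'e::euclidean_space) chart set \<Rightarrow> ('a, 'e) metric \<Rightarrow> bool" where
  "riemannian_metric A g \<longleftrightarrow>
     (\<forall>p. \<forall>v\<in>tangent_space A p. \<forall>w\<in>tangent_space A p. \<forall>z\<in>tangent_space A p. \<forall>a b.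
        g p (a *\<^sub>R v + b *\<^sub>R w) z = a * g p v z + b * g p w z) \<and>
     (\<forall>p. \<forall>v\<in>tangent_space A p. \<forall>w\<in>tangent_space A p. g p v w = g p w v) \<and>
     (\<forall>p. \<forall>v\<in>tangent_space A p. v \<noteq> 0 \<longrightarrow> g p v v > 0) \<and>
     (\<forall>c\<in>A. \<forall>e e'. smooth_on (cmap c ` cdom c)
        (\<lambda>u. g (cinv c u) (coord_vector A c (cinv c u) e) (coord_vector A c (cinv c u) e')))"

definition riemannian_manifold ::
  "('a::{t2_space,second_countable_topology}, 'e::euclidean_space) chart set \<Rightarrow>
   ('a, 'e) metric \<Rightarrow> bool" where
  "riemannian_manifold A g \<longleftrightarrow> smooth_manifold A \<and> riemannian_metric A g"


section \<open>The Levi-Civita connection\<close>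

type_synonym ('a, 'e) connection = "('a, 'e) vfield \<Rightarrow> ('a, 'e) vfield \<Rightarrow> ('a, 'e) vfield"

definition affine_connection ::
  "('a::topological_space, 'e::euclidean_space) chart set \<Rightarrow> ('a, 'e) connection \<Rightarrow> bool" where
  "affine_connection A nab \<longleftrightarrow>
     (\<forall>X\<in>vfields A. \<forall>Y\<in>vfields A. nab X Y \<in> vfields A) \<and>
     (\<forall>X\<in>vfields A. \<forall>X'\<in>vfields A. \<forall>Y\<in>vfields A. nab (X + X') Y = nab X Y + nab X' Y) \<and>
     (\<forall>X\<in>vfields A. \<forall>Y\<in>vfields A. \<forall>Y'\<in>vfields A. nab X (Y + Y') = nab X Y + nab X Y') \<and>
     (\<forall>X\<in>vfields A. \<forall>Y\<in>vfields A. \<forall>h. smooth_function A h \<longrightarrow>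
        nab (\<lambda>p. h p *\<^sub>R X p) Y = (\<lambda>p. h p *\<^sub>R nab X Y p) \<and>
        nab X (\<lambda>p. h p *\<^sub>R Y p) = (\<lambda>p. vec_apply A p (X p) h *\<^sub>R Y p + h p *\<^sub>R nab X Y p))"

text \<open>The conditions determine the values of \<open>nab\<close> on \<open>vfields A\<close> uniquely; nothing is said
  about the values on other arguments.\<close>

definition levi_civita ::
  "('a::topological_space, 'e::euclidean_space) chart set \<Rightarrow> ('a, 'e) metric \<Rightarrow>
   ('a, 'e) connection \<Rightarrow> bool" where
  "levi_civita A g nab \<longleftrightarrow> affine_connection A nab \<and>
     (\<forall>X\<in>vfields A. \<forall>Y\<in>vfields A. nab X Y - nab Y X = lie_bracket A X Y) \<and>
     (\<forall>X\<in>vfields A. \<forall>Y\<in>vfields A. \<forall>Z\<in>vfields A. \<forall>p.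
        vec_apply A p (X p) (\<lambda>q. g q (Y q) (Z q)) =
          g p (nab X Y p) (Z p) + g p (Y p) (nab X Z p))"

text \<open>\<open>cov_endo nab \<phi> X Y\<close> is \<open>(\<nabla>\<^sub>X \<phi>) Y = \<nabla>\<^sub>X (\<phi> Y) - \<phi> (\<nabla>\<^sub>X Y)\<close>.\<close>

definition cov_endo ::
  "('a, 'e::euclidean_space) connection \<Rightarrow> ('a \<Rightarrow> ('a, 'e) tvec \<Rightarrow> ('a, 'e) tvec) \<Rightarrow>
   ('a, 'e) connection" where
  "cov_endo nab \<phi> X Y = (\<lambda>p. nab X (\<lambda>q. \<phi> q (Y q)) p - \<phi> p (nab X Y p))"


section \<open>Almost contact metric manifolds\<close>

definition almost_contact_metric ::
  "('a::{t2_space,second_countable_topology}, 'e::euclidean_space) chart set \<Rightarrow>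
   ('a \<Rightarrow> ('a, 'e) tvec \<Rightarrow> ('a, 'e) tvec) \<Rightarrow> ('a, 'e) vfield \<Rightarrow>
   ('a \<Rightarrow> ('a, 'e) tvec \<Rightarrow> real) \<Rightarrow> ('a, 'e) metric \<Rightarrow> bool" where
  "almost_contact_metric A \<phi> \<xi> \<eta> g \<longleftrightarrow>
     riemannian_manifold A g \<and> (\<exists>n. DIM('e) = 2 * n + 1) \<and>
     endo_field A \<phi> \<and> \<xi> \<in> vfields A \<and> one_form A \<eta> \<and>
     (\<forall>p. \<forall>v\<in>tangent_space A p. \<phi> p (\<phi> p v) = - v + \<eta> p v *\<^sub>R \<xi> p) \<and>
     (\<forall>p. \<eta> p (\<xi> p) = 1) \<and>
     (\<forall>p. \<forall>v\<in>tangent_space A p. \<forall>w\<in>tangent_space A p.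
        g p (\<phi> p v) (\<phi> p w) = g p v w - \<eta> p v * \<eta> p w)"

text \<open>In the following three definitions \<open>nab\<close> stands for the Levi-Civita connection.\<close>

definition cosymplectic ::
  "('a::topological_space, 'e::euclidean_space) chart set \<Rightarrow>
   ('a \<Rightarrow> ('a, 'e) tvec \<Rightarrow> ('a, 'e) tvec) \<Rightarrow> ('a, 'e) connection \<Rightarrow> bool" where
  "cosymplectic A \<phi> nab \<longleftrightarrow>
     (\<forall>X\<in>vfields A. \<forall>Y\<in>vfields A. \<forall>p. cov_endo nab \<phi> X Y p = 0)"

definition sasakian ::
  "('a::topological_space, 'e::euclidean_space) chart set \<Rightarrow>
   ('a \<Rightarrow> ('a, 'e) tvec \<Rightarrow> ('a, 'e) tvec) \<Rightarrow> ('a, 'e) vfield \<Rightarrow>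
   ('a \<Rightarrow> ('a, 'e) tvec \<Rightarrow> real) \<Rightarrow> ('a, 'e) metric \<Rightarrow> ('a, 'e) connection \<Rightarrow> bool" where
  "sasakian A \<phi> \<xi> \<eta> g nab \<longleftrightarrow> (\<forall>X\<in>vfields A. \<forall>Y\<in>vfields A. \<forall>p.
     cov_endo nab \<phi> X Y p = g p (X p) (Y p) *\<^sub>R \<xi> p - \<eta> p (Y p) *\<^sub>R X p)"

definition kenmotsu ::
  "('a::topological_space, 'e::euclidean_space) chart set \<Rightarrow>
   ('a \<Rightarrow> ('a, 'e) tvec \<Rightarrow> ('a, 'e) tvec) \<Rightarrow> ('a, 'e) vfield \<Rightarrow>
   ('a \<Rightarrow> ('a, 'e) tvec \<Rightarrow> real) \<Rightarrow> ('a, 'e) metric \<Rightarrow> ('a, 'e) connection \<Rightarrow> bool" where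
  "kenmotsu A \<phi> \<xi> \<eta> g nab \<longleftrightarrow> (\<forall>X\<in>vfields A. \<forall>Y\<in>vfields A. \<forall>p.
     cov_endo nab \<phi> X Y p =
       g p (\<phi> p (X p)) (Y p) *\<^sub>R \<xi> p - \<eta> p (Y p) *\<^sub>R \<phi> p (X p))"


section \<open>Submanifolds\<close>

text \<open>A submanifold is a manifold \<open>M\<close> together with an immersion \<open>\<iota>\<close> into \<open>N\<close>; injectivity of
  \<open>\<iota>\<close> is not required, so immersed and embedded submanifolds are both covered.\<close>

definition immersion ::
  "('m::topological_space, 'k::euclidean_space) chart set \<Rightarrow>
   ('a::topological_space, 'e::euclidean_space) chart set \<Rightarrow> ('m \<Rightarrow> 'a) \<Rightarrow> bool" where
  "immersion A\<^sub>M A\<^sub>N \<iota> \<longleftrightarrow> smooth_map A\<^sub>M A\<^sub>N \<iota> \<and>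
     (\<forall>p. inj_on (differential A\<^sub>M A\<^sub>N \<iota> p) (tangent_space A\<^sub>M p))"

definition induced_metric ::
  "('m, 'k::euclidean_space) chart set \<Rightarrow> ('a, 'e::euclidean_space) chart set \<Rightarrow>
   ('m \<Rightarrow> 'a) \<Rightarrow> ('a, 'e) metric \<Rightarrow> ('m, 'k) metric" where
  "induced_metric A\<^sub>M A\<^sub>N \<iota> g p v w =
     g (\<iota> p) (differential A\<^sub>M A\<^sub>N \<iota> p v) (differential A\<^sub>M A\<^sub>N \<iota> p w)"

definition tangent_to_submanifold ::
  "('m, 'k::euclidean_space) chart set \<Rightarrow> ('a, 'e::euclidean_space) chart set \<Rightarrow>
   ('m \<Rightarrow> 'a) \<Rightarrow> ('a, 'e) vfield \<Rightarrow> bool" where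
  "tangent_to_submanifold A\<^sub>M A\<^sub>N \<iota> X \<longleftrightarrow>
     (\<forall>p. X (\<iota> p) \<in> differential A\<^sub>M A\<^sub>N \<iota> p ` tangent_space A\<^sub>M p)"


section \<open>Pointwise semi-slant submanifolds\<close>

text \<open>The angle between a nonzero vector \<open>v\<close> and a nonzero subspace \<open>W\<close> of an inner product
  space is the least angle between \<open>v\<close> and a nonzero vector of \<open>W\<close>.\<close>

definition subspace_angle ::
  "('v::real_vector \<Rightarrow> 'v \<Rightarrow> real) \<Rightarrow> 'v \<Rightarrow> 'v set \<Rightarrow> real" where
  "subspace_angle G v W =
     Inf {arccos (G v w / (sqrt (G v v) * sqrt (G w w))) | w. w \<in> W \<and> w \<noteq> 0}"

text \<open>Constancy of the angle entails that the angle is defined, that is, \<open>\<phi> X \<noteq> 0\<close> for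
  nonzero \<open>X \<in> D\<^sub>2\<close>.\<close>

definition pointwise_semi_slant ::
  "('m::{t2_space,second_countable_topology}, 'k::euclidean_space) chart set \<Rightarrow>
   ('a::{t2_space,second_countable_topology}, 'e::euclidean_space) chart set \<Rightarrow> ('m \<Rightarrow> 'a) \<Rightarrow>
   ('a \<Rightarrow> ('a, 'e) tvec \<Rightarrow> ('a, 'e) tvec) \<Rightarrow> ('a, 'e) metric \<Rightarrow>
   ('m \<Rightarrow> ('m, 'k) tvec set) \<Rightarrow> ('m \<Rightarrow> ('m, 'k) tvec set) \<Rightarrow> ('m \<Rightarrow> real) \<Rightarrow> bool" where
  "pointwise_semi_slant A\<^sub>M A\<^sub>N \<iota> \<phi> g D\<^sub>1 D\<^sub>2 \<theta> \<longleftrightarrow>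
     smooth_manifold A\<^sub>M \<and> immersion A\<^sub>M A\<^sub>N \<iota> \<and> distribution A\<^sub>M D\<^sub>1 \<and>
     (\<forall>p. D\<^sub>2 p = {w \<in> tangent_space A\<^sub>M p. \<forall>v\<in>D\<^sub>1 p. induced_metric A\<^sub>M A\<^sub>N \<iota> g p v w = 0}) \<and>
     (\<forall>p. D\<^sub>1 p \<inter> D\<^sub>2 p = {0} \<and> {v + w | v w. v \<in> D\<^sub>1 p \<and> w \<in> D\<^sub>2 p} = tangent_space A\<^sub>M p) \<and>
     (\<forall>p. \<forall>v\<in>D\<^sub>1 p. \<phi> (\<iota> p) (differential A\<^sub>M A\<^sub>N \<iota> p v) \<in> differential A\<^sub>M A\<^sub>N \<iota> p ` D\<^sub>1 p) \<and>
     (\<forall>p. \<forall>w\<in>D\<^sub>2 p. w \<noteq> 0 \<longrightarrow>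
        \<phi> (\<iota> p) (differential A\<^sub>M A\<^sub>N \<iota> p w) \<noteq> 0 \<and>
        subspace_angle (g (\<iota> p)) (\<phi> (\<iota> p) (differential A\<^sub>M A\<^sub>N \<iota> p w))
          (differential A\<^sub>M A\<^sub>N \<iota> p ` D\<^sub>2 p) = \<theta> p)"

definition proper_semi_slant :: "('m \<Rightarrow> real) \<Rightarrow> bool" where
  "proper_semi_slant \<theta> \<longleftrightarrow> (\<forall>p. 0 < \<theta> p \<and> \<theta> p < pi / 2)"


section \<open>Warped products\<close>

definition prod_atlas ::
  "('b, 'k::euclidean_space) chart set \<Rightarrow> ('f, 'l::euclidean_space) chart set \<Rightarrow>
   ('b \<times> 'f, 'k \<times> 'l) chart set" where
  "prod_atlas A\<^sub>B A\<^sub>F =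
     {(cdom c \<times> cdom d, map_prod (cmap c) (cmap d)) | c d. c \<in> A\<^sub>B \<and> d \<in> A\<^sub>F}"

definition warped_metric ::
  "('b, 'k::euclidean_space) chart set \<Rightarrow> ('b, 'k) metric \<Rightarrow>
   ('f, 'l::euclidean_space) chart set \<Rightarrow> ('f, 'l) metric \<Rightarrow> ('b \<Rightarrow> real) \<Rightarrow>
   ('b \<times> 'f, 'k \<times> 'l) metric" where
  "warped_metric A\<^sub>B g\<^sub>B A\<^sub>F g\<^sub>F f p v w =
     (let d\<^sub>B = differential (prod_atlas A\<^sub>B A\<^sub>F) A\<^sub>B fst p;
          d\<^sub>F = differential (prod_atlas A\<^sub>B A\<^sub>F) A\<^sub>F snd p
      in g\<^sub>B (fst p) (d\<^sub>B v) (d\<^sub>B w) + (f (fst p))\<^sup>2 * g\<^sub>F (snd p) (d\<^sub>F v) (d\<^sub>F w))"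

text \<open>The subbundles of the tangent bundle of a product that are identified with the tangent
  bundles of the two factors.\<close>

definition base_bundle ::
  "('b, 'k::euclidean_space) chart set \<Rightarrow> ('f, 'l::euclidean_space) chart set \<Rightarrow>
   'b \<times> 'f \<Rightarrow> ('b \<times> 'f, 'k \<times> 'l) tvec set" where
  "base_bundle A\<^sub>B A\<^sub>F p =
     differential A\<^sub>B (prod_atlas A\<^sub>B A\<^sub>F) (\<lambda>b. (b, snd p)) (fst p) ` tangent_space A\<^sub>B (fst p)"

definition fibre_bundle ::
  "('b, 'k::euclidean_space) chart set \<Rightarrow> ('f, 'l::euclidean_space) chart set \<Rightarrow>
   'b \<times> 'f \<Rightarrow> ('b \<times> 'f, 'k \<times> 'l) tvec set" where
  "fibre_bundle A\<^sub>B A\<^sub>F p =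
     differential A\<^sub>F (prod_atlas A\<^sub>B A\<^sub>F) (\<lambda>x. (fst p, x)) (snd p) ` tangent_space A\<^sub>F (snd p)"

definition warped_product_submanifold ::
  "('b::{t2_space,second_countable_topology}, 'k::euclidean_space) chart set \<Rightarrow> ('b, 'k) metric \<Rightarrow>
   ('f::{t2_space,second_countable_topology}, 'l::euclidean_space) chart set \<Rightarrow> ('f, 'l) metric \<Rightarrow>
   ('b \<Rightarrow> real) \<Rightarrow>
   ('a::{t2_space,second_countable_topology}, 'e::euclidean_space) chart set \<Rightarrow> ('a, 'e) metric \<Rightarrow>
   ('b \<times> 'f \<Rightarrow> 'a) \<Rightarrow> bool" where
  "warped_product_submanifold A\<^sub>B g\<^sub>B A\<^sub>F g\<^sub>F f A\<^sub>N g \<iota> \<longleftrightarrow>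
     riemannian_manifold A\<^sub>B g\<^sub>B \<and> riemannian_manifold A\<^sub>F g\<^sub>F \<and>
     smooth_function A\<^sub>B f \<and> (\<forall>b. f b > 0) \<and>
     immersion (prod_atlas A\<^sub>B A\<^sub>F) A\<^sub>N \<iota> \<and>
     (\<forall>p. \<forall>v\<in>tangent_space (prod_atlas A\<^sub>B A\<^sub>F) p. \<forall>w\<in>tangent_space (prod_atlas A\<^sub>B A\<^sub>F) p.
        induced_metric (prod_atlas A\<^sub>B A\<^sub>F) A\<^sub>N \<iota> g p v w = warped_metric A\<^sub>B g\<^sub>B A\<^sub>F g\<^sub>F f p v w)"

text \<open>This notion presupposes the convention that manifolds are connected: on a disconnected base a
  locally constant \<open>f\<close> need not be constant.\<close>

definition trivial_warping :: "('b \<Rightarrow> real) \<Rightarrow> bool" where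
  "trivial_warping f \<longleftrightarrow> (\<exists>r. \<forall>b. f b = r)"

end

theory Submission
  imports Defs
begin

text \<open>
  In each of the three cases \<open>\<nabla>\<^sub>\<xi> \<xi> = 0\<close>. As \<open>\<xi>\<close> has unit length and \<open>\<eta>\<close> is its metric dual, this
  amounts to \<open>d\<eta>(\<xi>, V) = 0\<close> for all \<open>V\<close>. If \<open>\<xi>\<close> had a component \<open>w \<noteq> 0\<close> in \<open>D\<^sub>2\<close>, then
  \<open>\<phi> w\<close> would lie in \<open>D\<^sub>1\<close>, orthogonally to \<open>D\<^sub>2\<close>, and the slant angle would be \<open>\<pi> / 2\<close>; hence
  \<open>\<xi>\<close> is tangent to the fibres and the pullback \<open>\<alpha>\<close> of \<open>\<eta>\<close> to \<open>B \<times> F\<close> vanishes on base vectors.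
  For the value \<open>\<zeta>\<close> of \<open>\<xi>\<close> at \<open>(b\<^sub>0, y)\<close>, \<open>d\<alpha>(\<xi>, _) = 0\<close> then makes the function
  \<open>s(b) = \<alpha>(b, y)(\<zeta>)\<close> critical at \<open>b\<^sub>0\<close>. The Cauchy-Schwarz inequality in the fibre gives
  \<open>f(b\<^sub>0)\<^sup>2 s(b)\<^sup>2 \<le> f(b)\<^sup>2\<close> with equality at \<open>b\<^sub>0\<close>, so \<open>b\<^sub>0\<close> is a critical point of \<open>f\<close>. Since
  \<open>b\<^sub>0\<close> is arbitrary and \<open>B\<close> is connected, \<open>f\<close> is constant.
\<close>


section \<open>Calculus of smooth functions\<close>

lemma has_frechet_derivative:
  "f differentiable (at x) \<Longrightarrow> (f has_derivative frechet_derivative f (at x)) (at x)"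
  by (simp add: frechet_derivative_works)

lemma frechet_derivative_eq:
  "(f has_derivative f') (at x) \<Longrightarrow> frechet_derivative f (at x) = f'"
  using frechet_derivative_at by blast

lemma differentiable_cong_open:
  assumes "f differentiable (at x)" "open S" "x \<in> S" "\<And>y. y \<in> S \<Longrightarrow> f y = g y"
  shows "g differentiable (at x)"
  using assms unfolding differentiable_def by (meson has_derivative_transform_within_open)

text \<open>\<open>Ck_on\<close> differentiates at points of the whole space, so values outside the
  set could interfere; openness confines the derivative to values inside.\<close>

lemma Ck_on_cong:
  assumes "open S" "Ck_on k S f" "\<And>x. x \<in> S \<Longrightarrow> f x = g x"
  shows "Ck_on k S g"
  using assms(2,3)
proof (induction k arbitrary: f g)
  case 0
  then show ?case using continuous_on_cong[of S S f g] by simp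
next
  case (Suc k)
  have "g differentiable (at x)" if "x \<in> S" for x
    using differentiable_cong_open[OF _ assms(1) that] Suc.prems that by fastforce
  moreover have "Ck_on k S (\<lambda>x. frechet_derivative g (at x) v)" for v
  proof (rule Suc.IH)
    show "Ck_on k S (\<lambda>x. frechet_derivative f (at x) v)" using Suc.prems by simp
    show "frechet_derivative f (at x) v = frechet_derivative g (at x) v" if "x \<in> S" for x
      using frechet_derivative_transform_within_open[of f x S g] Suc.prems that assms(1) by simp
  qed
  ultimately show ?case by simp
qed

lemma Ck_on_SucD: "Ck_on (Suc k) S f \<Longrightarrow> Ck_on k S f"
proof (induction k arbitrary: f)
  case 0
  then show ?case
    by (auto simp: intro!: continuous_at_imp_continuous_on differentiable_imp_continuous_within)
next
  case (Suc k)
  then have "Ck_on k S (\<lambda>x. frechet_derivative f (at x) v)" for v by simp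
  with Suc.prems show ?case by simp
qed

lemma Ck_on_Un: "open S \<Longrightarrow> open T \<Longrightarrow> Ck_on k S f \<Longrightarrow> Ck_on k T f \<Longrightarrow> Ck_on k (S \<union> T) f"
  by (induction k arbitrary: f) (auto intro: continuous_on_open_Un)

lemma Ck_on_const: "Ck_on k S (\<lambda>x. c)"
  by (induction k arbitrary: c) auto

lemma Ck_on_bounded_linear:
  assumes "bounded_linear L" "open S" "Ck_on k S f"
  shows "Ck_on k S (\<lambda>x. L (f x))"
  using assms(3)
proof (induction k arbitrary: f)
  case 0
  then show ?case using assms by (simp add: bounded_linear.continuous_on)
next
  case (Suc k)
  have d: "((\<lambda>x. L (f x)) has_derivative (\<lambda>v. L (frechet_derivative f (at x) v))) (at x)"
    if "x \<in> S" for x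
    by (rule bounded_linear.has_derivative[OF assms(1)], rule has_frechet_derivative)
      (use Suc.prems that in simp)
  have "Ck_on k S (\<lambda>x. frechet_derivative (\<lambda>x. L (f x)) (at x) v)" for v
  proof (rule Ck_on_cong[OF assms(2)])
    show "Ck_on k S (\<lambda>x. L (frechet_derivative f (at x) v))"
      by (rule Suc.IH) (use Suc.prems in simp)
  qed (simp add: frechet_derivative_eq[OF d])
  then show ?case using d by (auto simp: differentiable_def)
qed

lemma Ck_on_add:
  assumes "open S" "Ck_on k S f" "Ck_on k S g"
  shows "Ck_on k S (\<lambda>x. f x + g x)"
  using assms(2,3)
proof (induction k arbitrary: f g)
  case 0
  then show ?case by (simp add: continuous_on_add)
next
  case (Suc k)
  have d: "((\<lambda>x. f x + g x) has_derivative
      (\<lambda>v. frechet_derivative f (at x) v + frechet_derivative g (at x) v)) (at x)"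
    if "x \<in> S" for x
    using Suc.prems that by (auto intro!: has_derivative_add has_frechet_derivative)
  have "Ck_on k S (\<lambda>x. frechet_derivative (\<lambda>x. f x + g x) (at x) v)" for v
  proof (rule Ck_on_cong[OF assms(1)])
    show "Ck_on k S (\<lambda>x. frechet_derivative f (at x) v + frechet_derivative g (at x) v)"
      by (rule Suc.IH) (use Suc.prems in simp_all)
  qed (simp add: frechet_derivative_eq[OF d])
  then show ?case using d by (auto simp: differentiable_def)
qed

lemma Ck_on_sum:
  assumes "open S" "\<And>i. i \<in> I \<Longrightarrow> Ck_on k S (f i)"
  shows "Ck_on k S (\<lambda>x. \<Sum>i\<in>I. f i x)"
  using assms(2)
  by (induction I rule: infinite_finite_induct) (auto intro: Ck_on_const Ck_on_add[OF assms(1)])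

lemma Ck_on_scaleR:
  assumes "open S" "Ck_on k S f" "Ck_on k S g"
  shows "Ck_on k S (\<lambda>x. f x *\<^sub>R g x)"
  using assms(2,3)
proof (induction k arbitrary: f g)
  case 0
  then show ?case by (simp add: continuous_on_scaleR)
next
  case (Suc k)
  have d: "((\<lambda>x. f x *\<^sub>R g x) has_derivative
      (\<lambda>v. f x *\<^sub>R frechet_derivative g (at x) v + frechet_derivative f (at x) v *\<^sub>R g x)) (at x)"
    if "x \<in> S" for x
    using Suc.prems that by (auto intro!: has_derivative_scaleR has_frechet_derivative)
  have "Ck_on k S (\<lambda>x. frechet_derivative (\<lambda>x. f x *\<^sub>R g x) (at x) v)" for v
  proof (rule Ck_on_cong[OF assms(1)])
    \<comment> \<open>Each product pairs a derivative with an undifferentiated factor, which has to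
      be lowered from class k + 1 to class k before the induction hypothesis applies.\<close>
    show "Ck_on k S
      (\<lambda>x. f x *\<^sub>R frechet_derivative g (at x) v + frechet_derivative f (at x) v *\<^sub>R g x)"
      by (intro Ck_on_add assms(1) Suc.IH)
        (use Suc.prems Suc.prems[THEN Ck_on_SucD] in simp_all)
  qed (simp add: frechet_derivative_eq[OF d])
  then show ?case using d by (auto simp: differentiable_def)
qed

text \<open>Turns a derivative in a varying direction into derivatives in the finitely many basis
  directions, which smoothness conditions for fixed directions control.\<close>

lemma linear_Basis_expansion:
  fixes L :: "'a::euclidean_space \<Rightarrow> 'b::real_vector"
  assumes "linear L"
  shows "L v = (\<Sum>b\<in>Basis. (v \<bullet> b) *\<^sub>R L b)"
proof -
  have "L v = L (\<Sum>b\<in>Basis. (v \<bullet> b) *\<^sub>R b)" by (simp add: euclidean_representation)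
  also have "\<dots> = (\<Sum>b\<in>Basis. (v \<bullet> b) *\<^sub>R L b)"
    using assms by (simp add: linear_sum linear_scale)
  finally show ?thesis .
qed

text \<open>By the chain rule the derivative of g is applied to a direction that moves with the
  point, whereas \<open>Ck_on\<close> speaks of fixed directions. Expanding that direction in the
  basis leaves sums of products covered by the induction hypothesis, which is therefore general in
  g.\<close>

lemma Ck_on_compose:
  fixes f :: "'a::euclidean_space \<Rightarrow> 'b::euclidean_space" and g :: "'b \<Rightarrow> 'c::real_normed_vector"
  assumes "open S" "Ck_on k S f" "Ck_on k T g" "f ` S \<subseteq> T"
  shows "Ck_on k S (\<lambda>x. g (f x))"
  using assms(2,3)
proof (induction k arbitrary: g)
  case 0
  then show ?case using assms(4) by (auto intro: continuous_on_compose2)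
next
  case (Suc k)
  have dg: "g differentiable (at (f x))" if "x \<in> S" for x
    using Suc.prems that assms(4) by auto
  have d: "((\<lambda>x. g (f x)) has_derivative
      (\<lambda>v. frechet_derivative g (at (f x)) (frechet_derivative f (at x) v))) (at x)"
    if "x \<in> S" for x
    using has_derivative_compose[of f "frechet_derivative f (at x)" x UNIV g,
        OF has_frechet_derivative has_frechet_derivative[OF dg[OF that]]] Suc.prems that by simp
  have "Ck_on k S (\<lambda>x. frechet_derivative (\<lambda>x. g (f x)) (at x) v)" for v
  proof (rule Ck_on_cong[OF assms(1)])
    show "Ck_on k S (\<lambda>x. \<Sum>b\<in>Basis.
      (frechet_derivative f (at x) v \<bullet> b) *\<^sub>R frechet_derivative g (at (f x)) b)"
      using Suc.prems Ck_on_SucD[OF Suc.prems(1)]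
      by (intro Ck_on_sum Ck_on_scaleR assms(1) Suc.IH
          Ck_on_bounded_linear[OF bounded_linear_inner_left]) auto
    show "(\<Sum>b\<in>Basis. (frechet_derivative f (at x) v \<bullet> b) *\<^sub>R frechet_derivative g (at (f x)) b)
      = frechet_derivative (\<lambda>x. g (f x)) (at x) v" if "x \<in> S" for x
      unfolding frechet_derivative_eq[OF d[OF that]]
      by (rule linear_Basis_expansion[OF linear_frechet_derivative[OF dg[OF that]], symmetric])
  qed
  then show ?case using d by (auto simp: differentiable_def)
qed

section \<open>From class k to class C-infinity\<close>

lemma smooth_onD_differentiable: "smooth_on S f \<Longrightarrow> x \<in> S \<Longrightarrow> f differentiable (at x)"
  by (simp add: smooth_on_def) (metis Ck_on.simps(2))

lemma smooth_on_imp_Ck_on: "smooth_on S f \<Longrightarrow> Ck_on k S f"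
  by (simp add: smooth_on_def)

lemma smooth_on_frechet_derivative:
  "smooth_on S f \<Longrightarrow> smooth_on S (\<lambda>x. frechet_derivative f (at x) v)"
  by (simp add: smooth_on_def) (metis Ck_on.simps(2))

lemma smooth_on_compose:
  fixes f :: "'a::euclidean_space \<Rightarrow> 'b::euclidean_space" and g :: "'b \<Rightarrow> 'c::real_normed_vector"
  assumes "open S" "smooth_on S f" "smooth_on T g" "f ` S \<subseteq> T"
  shows "smooth_on S (\<lambda>x. g (f x))"
  using assms unfolding smooth_on_def by (blast intro: Ck_on_compose)

lemma smooth_on_scaleR:
  "open S \<Longrightarrow> smooth_on S f \<Longrightarrow> smooth_on S g \<Longrightarrow> smooth_on S (\<lambda>x. f x *\<^sub>R g x)"
  by (simp add: smooth_on_def Ck_on_scaleR)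

lemma smooth_on_cong:
  "open S \<Longrightarrow> smooth_on S f \<Longrightarrow> (\<And>x. x \<in> S \<Longrightarrow> f x = g x) \<Longrightarrow> smooth_on S g"
  by (simp add: smooth_on_def) (metis Ck_on_cong)

lemma smooth_on_Un:
  "open S \<Longrightarrow> open T \<Longrightarrow> smooth_on S f \<Longrightarrow> smooth_on T f \<Longrightarrow> smooth_on (S \<union> T) f"
  by (simp add: smooth_on_def Ck_on_Un)

lemma smooth_on_const: "smooth_on S (\<lambda>x. c)"
  by (simp add: smooth_on_def Ck_on_const)


subsection \<open>Bump functions\<close>

text \<open>The factor \<open>1 / t ^ n\<close> makes this family closed under differentiation.\<close>

definition exp_flat :: "nat \<Rightarrow> real \<Rightarrow> real" where
  "exp_flat n t = (if t \<le> 0 then 0 else exp (- (1 / t)) / t ^ n)"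

text \<open>Away from 0 only elementary calculus is involved; at 0 the exponential decay beats every
  power of 1 / t.\<close>

lemma exp_flat_has_derivative:
  "(exp_flat n has_real_derivative exp_flat (n + 2) t - real n * exp_flat (n + 1) t) (at t)"
proof -
  consider "t < 0" | "t = 0" | "t > 0" by linarith
  then show ?thesis
  proof cases
    case 1
    have "((\<lambda>_. 0) has_real_derivative 0) (at t)" by simp
    then have "(exp_flat n has_real_derivative 0) (at t)"
      by (rule has_field_derivative_transform_within_open[where S = "{..<0}"])
        (use 1 in \<open>auto simp: exp_flat_def\<close>)
    then show ?thesis using 1 by (simp add: exp_flat_def)
  next
    case 3
    have "((\<lambda>t. exp (- (1 / t)) / t ^ n) has_real_derivative
      exp_flat (n + 2) t - real n * exp_flat (n + 1) t) (at t)"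
    proof (cases n)
      case (Suc m)
      \<comment> \<open>The power rule yields the exponent n - Suc 0, a truncated subtraction, so n
        = 0 is treated apart.\<close>
      have "t * t ^ (n - Suc 0) = t ^ n" using Suc by simp
      with 3 show ?thesis
        by (auto intro!: derivative_eq_intros simp: exp_flat_def divide_simps power2_eq_square algebra_simps)
    qed (use 3 in \<open>auto intro!: derivative_eq_intros
        simp: exp_flat_def divide_simps power2_eq_square algebra_simps\<close>)
    then show ?thesis
      by (rule has_field_derivative_transform_within_open[where S = "{0<..}"])
        (use 3 in \<open>auto simp: exp_flat_def\<close>)
  next
    case 2
    \<comment> \<open>As \<open>exp_flat n 0 = 0\<close>, this is the difference quotient at 0. On
      the right, x = 1 / t turns it into x ^ Suc n / exp x as x grows.\<close>
    have lim: "((\<lambda>t. exp_flat n t / t) \<longlongrightarrow> 0) (at 0)"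
    proof (rule filterlim_split_at)
      have "\<forall>\<^sub>F t in at_left 0. 0 = exp_flat n t / t"
        by (simp add: eventually_at_filter exp_flat_def)
      then show "((\<lambda>t. exp_flat n t / t) \<longlongrightarrow> 0) (at_left 0)"
        by (rule Lim_transform_eventually[rotated]) simp
      have "((\<lambda>x. (inverse x) ^ Suc n / exp (inverse x)) \<longlongrightarrow> (0::real)) (at_right 0)"
        by (rule filterlim_compose[OF tendsto_power_div_exp_0 filterlim_inverse_at_top_right])
      moreover have "\<forall>\<^sub>F t in at_right 0. (inverse t) ^ Suc n / exp (inverse t) = exp_flat n t / t"
        by (simp add: eventually_at_filter exp_flat_def exp_minus divide_simps)
      ultimately show "((\<lambda>t. exp_flat n t / t) \<longlongrightarrow> 0) (at_right 0)"
        by (rule Lim_transform_eventually)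
    qed
    then have "(exp_flat n has_real_derivative 0) (at 0)"
      by (simp add: DERIV_def exp_flat_def)
    then show ?thesis using 2 by (simp add: exp_flat_def)
  qed
qed

lemma smooth_exp_flat: "smooth_on UNIV (exp_flat n)"
proof -
  have "Ck_on k UNIV (exp_flat n)" for k
  proof (induction k arbitrary: n)
    case 0
    then show ?case
      unfolding Ck_on.simps
      by (intro continuous_at_imp_continuous_on ballI DERIV_isCont[OF exp_flat_has_derivative])
  next
    case (Suc k)
    have d: "(exp_flat n has_derivative
        (\<lambda>v. v *\<^sub>R (exp_flat (n + 2) t + (- real n) *\<^sub>R exp_flat (n + 1) t))) (at t)" for n t
      using exp_flat_has_derivative[of n t] unfolding has_field_derivative_def
      by (simp add: mult_commute_abs)
    have "Ck_on k UNIV (\<lambda>t. v *\<^sub>R (exp_flat (n + 2) t + (- real n) *\<^sub>R exp_flat (n + 1) t))" for v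
      by (intro Ck_on_scaleR Ck_on_add Ck_on_const Suc.IH open_UNIV)
    then show ?case
      using d by (simp add: frechet_derivative_eq[OF d]) (auto simp: differentiable_def)
  qed
  then show ?thesis by (simp add: smooth_on_def)
qed

text \<open>The function is \<open>exp_flat 0\<close> applied to
  \<open>r\<^sup>2 - |x - u|\<^sup>2\<close>, an argument that is positive exactly inside the
  ball.\<close>

lemma smooth_bump_exists:
  fixes u :: "'a::euclidean_space"
  assumes "r > 0"
  obtains h :: "'a \<Rightarrow> real" where "smooth_on UNIV h" "h u > 0" "\<And>x. x \<notin> ball u r \<Longrightarrow> h x = 0"
proof
  define q where "q x = r\<^sup>2 - (x - u) \<bullet> (x - u)" for x
  have "Ck_on k UNIV (\<lambda>x. x - u)" for k
  proof (cases k)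
    case (Suc j)
    have "((\<lambda>x. x - u) has_derivative (\<lambda>v. v)) (at x)" for x
      by (auto intro!: derivative_eq_intros)
    note d = this
    show ?thesis
      using Suc d by (auto simp: frechet_derivative_eq[OF d] differentiable_def Ck_on_const)
  qed (auto intro!: continuous_intros)
  \<comment> \<open>The squared norm is written as a sum over coordinates so that the rules for sums
    and products apply to it.\<close>
  then have "Ck_on k UNIV (\<lambda>x. r\<^sup>2 + (-1) *\<^sub>R (\<Sum>b\<in>Basis. ((x - u) \<bullet> b) *\<^sub>R ((x - u) \<bullet> b)))" for k
    by (intro Ck_on_add Ck_on_const Ck_on_scaleR Ck_on_sum open_UNIV
        Ck_on_bounded_linear[OF bounded_linear_inner_left])
  then have "smooth_on UNIV q"
    unfolding smooth_on_def q_def by (subst euclidean_inner) simp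
  then show "smooth_on UNIV (\<lambda>x. exp_flat 0 (q x))"
    by (rule smooth_on_compose[OF open_UNIV _ smooth_exp_flat]) simp
  show "exp_flat 0 (q u) > 0" using assms by (simp add: q_def exp_flat_def)
  show "exp_flat 0 (q x) = 0" if "x \<notin> ball u r" for x
  proof -
    have "r\<^sup>2 \<le> (norm (x - u))\<^sup>2"
      using that assms by (intro power_mono) (auto simp: dist_norm norm_minus_commute)
    then show ?thesis by (simp add: q_def exp_flat_def power2_norm_eq_inner)
  qed
qed


subsection \<open>Symmetry of the second derivative\<close>

text \<open>The second difference over the parallelogram spanned by t v and t w is the increment of
  a difference along v. The mean value theorem in direction v and then in direction w turns it into
  a mixed derivative at a point of the parallelogram.\<close>

lemma second_difference_mvt:
  fixes F :: "'a::euclidean_space \<Rightarrow> real"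
  assumes F: "Ck_on 2 S F" and S: "ball z r \<subseteq> S"
    and t: "0 < t" "t * (norm v + norm w) < r"
  shows "\<exists>y. dist z y < r \<and> dist z y \<le> t * (norm v + norm w) \<and>
    F (z + t *\<^sub>R v + t *\<^sub>R w) - F (z + t *\<^sub>R v) - F (z + t *\<^sub>R w) + F z =
    t\<^sup>2 * frechet_derivative (\<lambda>x. frechet_derivative F (at x) v) (at y) w"
proof -
  let ?F1 = "\<lambda>x. frechet_derivative F (at x) v"
  have inB: "dist z (z + a *\<^sub>R v + b *\<^sub>R w) \<le> t * (norm v + norm w)"
    if "0 \<le> a" "a \<le> t" "0 \<le> b" "b \<le> t" for a b
  proof -
    have "dist z (z + a *\<^sub>R v + b *\<^sub>R w) = norm (a *\<^sub>R v + b *\<^sub>R w)"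
      by (metis add.assoc dist_commute dist_norm add_diff_cancel_left')
    also have "\<dots> \<le> a * norm v + b * norm w"
      using that by (metis abs_of_nonneg norm_scaleR norm_triangle_ineq)
    also have "\<dots> \<le> t * norm v + t * norm w"
      using that by (intro add_mono mult_right_mono) auto
    finally show ?thesis by (simp add: algebra_simps)
  qed
  have inS: "z + a *\<^sub>R v + b *\<^sub>R w \<in> S"
    if "0 \<le> a" "a \<le> t" "0 \<le> b" "b \<le> t" for a b
    using inB[OF that] t S by (auto simp: subset_iff)
  have dF: "(F has_derivative frechet_derivative F (at x)) (at x)" if "x \<in> S" for x
    using F that by (auto simp: numeral_2_eq_2 intro: has_frechet_derivative)
  have dF1: "(?F1 has_derivative frechet_derivative ?F1 (at x)) (at x)" if "x \<in> S" for x
    using F that by (auto simp: numeral_2_eq_2 intro: has_frechet_derivative)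
  \<comment> \<open>G compares F on the two edges parallel to v; its increment over [0, t] is the
    second difference. Writing \<open>0 *\<^sub>R w\<close> lets one derivative computation serve
    both edges.\<close>
  define G where "G s = F (z + s *\<^sub>R v + t *\<^sub>R w) - F (z + s *\<^sub>R v + 0 *\<^sub>R w)" for s
  have "(G has_real_derivative ?F1 (z + s *\<^sub>R v + t *\<^sub>R w) - ?F1 (z + s *\<^sub>R v + 0 *\<^sub>R w)) (at s)"
    if "0 \<le> s" "s \<le> t" for s
  proof -
    have "((\<lambda>s. F (z + s *\<^sub>R v + b *\<^sub>R w)) has_real_derivative ?F1 (z + s *\<^sub>R v + b *\<^sub>R w)) (at s)"
      if b: "0 \<le> b" "b \<le> t" for b
    proof -
      have "z + s *\<^sub>R v + b *\<^sub>R w \<in> S" using inS that b \<open>0 \<le> s\<close> \<open>s \<le> t\<close> by blast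
      note D = dF[OF this]
      have "((\<lambda>s. z + s *\<^sub>R v + b *\<^sub>R w) has_derivative (\<lambda>h. h *\<^sub>R v)) (at s)"
        by (auto intro!: derivative_eq_intros)
      from has_derivative_compose[OF this D] show ?thesis
        unfolding has_field_derivative_def
        using linear_scale[OF has_derivative_linear[OF D]] by (simp add: mult_commute_abs)
    qed
    from this[of t] this[of 0] show ?thesis
      unfolding G_def using t by (intro DERIV_diff) auto
  qed
  then obtain s where s: "0 < s" "s < t"
    and e1: "G t - G 0 = t * (?F1 (z + s *\<^sub>R v + t *\<^sub>R w) - ?F1 (z + s *\<^sub>R v + 0 *\<^sub>R w))"
    using MVT2[of 0 t G "\<lambda>s. ?F1 (z + s *\<^sub>R v + t *\<^sub>R w) - ?F1 (z + s *\<^sub>R v + 0 *\<^sub>R w)"] t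
    by auto
  have "((\<lambda>b. ?F1 (z + s *\<^sub>R v + b *\<^sub>R w)) has_real_derivative
      frechet_derivative ?F1 (at (z + s *\<^sub>R v + b *\<^sub>R w)) w) (at b)"
    if b: "0 \<le> b" "b \<le> t" for b
  proof -
    have "z + s *\<^sub>R v + b *\<^sub>R w \<in> S" using inS b s by simp
    note D = dF1[OF this]
    have "((\<lambda>b. z + s *\<^sub>R v + b *\<^sub>R w) has_derivative (\<lambda>h. h *\<^sub>R w)) (at b)"
      by (auto intro!: derivative_eq_intros)
    from has_derivative_compose[OF this D] show ?thesis
      unfolding has_field_derivative_def
      using linear_scale[OF has_derivative_linear[OF D]]
      by (simp add: mult_commute_abs)
  qed
  then obtain b where b: "0 < b" "b < t"
    and e2: "?F1 (z + s *\<^sub>R v + t *\<^sub>R w) - ?F1 (z + s *\<^sub>R v + 0 *\<^sub>R w) =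
      t * frechet_derivative ?F1 (at (z + s *\<^sub>R v + b *\<^sub>R w)) w"
    using MVT2[of 0 t "\<lambda>b. ?F1 (z + s *\<^sub>R v + b *\<^sub>R w)"
        "\<lambda>b. frechet_derivative ?F1 (at (z + s *\<^sub>R v + b *\<^sub>R w)) w"] t
    by auto
  have "dist z (z + s *\<^sub>R v + b *\<^sub>R w) \<le> t * (norm v + norm w)" using inB s b by simp
  moreover have "G t - G 0 = t\<^sup>2 * frechet_derivative ?F1 (at (z + s *\<^sub>R v + b *\<^sub>R w)) w"
    using e1 e2 by (simp add: power2_eq_square)
  moreover have "G t - G 0 = F (z + t *\<^sub>R v + t *\<^sub>R w) - F (z + t *\<^sub>R v) - F (z + t *\<^sub>R w) + F z"
    by (simp add: G_def)
  ultimately show ?thesis using t by (intro exI[of _ "z + s *\<^sub>R v + b *\<^sub>R w"]) auto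
qed

text \<open>The second difference is symmetric in v and w, so the two mixed derivatives agree at a
  pair of points near z; continuity brings both points back to z.\<close>

lemma second_derivative_symmetric_real:
  fixes F :: "'a::euclidean_space \<Rightarrow> real"
  assumes S: "open S" "z \<in> S" and F: "Ck_on 2 S F"
  shows "frechet_derivative (\<lambda>x. frechet_derivative F (at x) v) (at z) w =
    frechet_derivative (\<lambda>x. frechet_derivative F (at x) w) (at z) v" (is "?A z = ?B z")
proof (rule ccontr)
  assume ne: "?A z \<noteq> ?B z"
  \<comment> \<open>Half the supposed gap: two errors below e cannot add up to it.\<close>
  define e where "e = \<bar>?A z - ?B z\<bar> / 2"
  have "e > 0" using ne by (simp add: e_def)
  have "continuous_on S ?A" "continuous_on S ?B" using F by (simp_all add: numeral_2_eq_2)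
  then have cont: "isCont ?A z" "isCont ?B z"
    using S unfolding continuous_on_eq_continuous_at[OF S(1)] by blast+
  obtain d1 where d1: "d1 > 0" "\<And>y. dist y z < d1 \<Longrightarrow> dist (?A y) (?A z) < e"
    using cont(1) \<open>e > 0\<close> unfolding continuous_at_eps_delta by blast
  obtain d2 where d2: "d2 > 0" "\<And>y. dist y z < d2 \<Longrightarrow> dist (?B y) (?B z) < e"
    using cont(2) \<open>e > 0\<close> unfolding continuous_at_eps_delta by blast
  note d = d1 d2
  obtain r where r: "r > 0" "ball z r \<subseteq> S"
    using S openE by blast
  define m where "m = min r (min d1 d2)"
  have m: "m > 0" "ball z m \<subseteq> S" using r d by (auto simp: m_def)
  \<comment> \<open>The summand 1 keeps the denominator positive when v = w = 0 and makes t (|v| +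
    |w|) strictly less than m.\<close>
  define t where "t = m / (norm v + norm w + 1)"
  have pos: "norm v + norm w + 1 > 0" by (smt (verit) norm_ge_zero)
  have t: "t > 0" using m pos by (simp add: t_def)
  have tm: "t * (norm v + norm w) < m"
  proof -
    have "t * (norm v + norm w) < t * (norm v + norm w + 1)" using t by simp
    also have "\<dots> = m" using pos by (simp add: t_def)
    finally show ?thesis .
  qed
  have tm': "t * (norm w + norm v) < m" using tm by (simp add: add.commute)
  obtain y1 where y1: "dist z y1 < m"
    "F (z + t *\<^sub>R v + t *\<^sub>R w) - F (z + t *\<^sub>R v) - F (z + t *\<^sub>R w) + F z = t\<^sup>2 * ?A y1"
    using second_difference_mvt[OF F m(2) t tm] by blast
  obtain y2 where y2: "dist z y2 < m"
    "F (z + t *\<^sub>R w + t *\<^sub>R v) - F (z + t *\<^sub>R w) - F (z + t *\<^sub>R v) + F z = t\<^sup>2 * ?B y2"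
    using second_difference_mvt[OF F m(2) t tm'] by blast
  have "t\<^sup>2 * ?A y1 = t\<^sup>2 * ?B y2"
    unfolding y1(2)[symmetric] y2(2)[symmetric] by (simp add: ac_simps)
  then have "?A y1 = ?B y2" using t by simp
  moreover have "dist (?A y1) (?A z) < e" "dist (?B y2) (?B z) < e"
    using y1 y2 d by (auto simp: m_def dist_commute)
  moreover have "dist (?A z) (?B z) \<le> dist (?A y1) (?A z) + dist (?A y1) (?B z)"
    by (rule dist_triangle3)
  ultimately have "dist (?A z) (?B z) < e + e" by simp
  then show False by (simp add: e_def dist_real_def)
qed

text \<open>The mean value theorem behind the real case fails for vector values, so the argument
  goes through components.\<close>

lemma second_derivative_symmetric:
  fixes F :: "'a::euclidean_space \<Rightarrow> 'b::euclidean_space"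
  assumes S: "open S" "z \<in> S" and F: "Ck_on 2 S F"
  shows "frechet_derivative (\<lambda>x. frechet_derivative F (at x) v) (at z) w =
    frechet_derivative (\<lambda>x. frechet_derivative F (at x) w) (at z) v"
proof (rule euclidean_eqI)
  fix b :: 'b assume "b \<in> Basis"
  have Fb: "Ck_on 2 S (\<lambda>x. F x \<bullet> b)"
    by (rule Ck_on_bounded_linear[OF bounded_linear_inner_left S(1) F])
  have *: "frechet_derivative (\<lambda>x. G x \<bullet> b) (at x) = (\<lambda>v. frechet_derivative G (at x) v \<bullet> b)"
    if "G differentiable (at x)" for G :: "'a \<Rightarrow> 'b" and x
    by (rule frechet_derivative_eq,
        rule bounded_linear.has_derivative[OF bounded_linear_inner_left has_frechet_derivative[OF that]])
  have D: "frechet_derivative (\<lambda>x. frechet_derivative (\<lambda>x. F x \<bullet> b) (at x) v) (at z) w =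
      frechet_derivative (\<lambda>x. frechet_derivative F (at x) v) (at z) w \<bullet> b" for v w
  proof -
    have "frechet_derivative (\<lambda>x. frechet_derivative F (at x) v \<bullet> b) (at z) =
      frechet_derivative (\<lambda>x. frechet_derivative (\<lambda>x. F x \<bullet> b) (at x) v) (at z)"
    proof (rule frechet_derivative_transform_within_open[OF _ S])
      show "(\<lambda>x. frechet_derivative F (at x) v \<bullet> b) differentiable (at z)"
        using F S by (auto simp: numeral_2_eq_2)
      show "frechet_derivative F (at x) v \<bullet> b = frechet_derivative (\<lambda>x. F x \<bullet> b) (at x) v"
        if "x \<in> S" for x
        using * F that by (simp add: numeral_2_eq_2)
    qed
    moreover have "(\<lambda>x. frechet_derivative F (at x) v) differentiable (at z)"
      using F S by (auto simp: numeral_2_eq_2)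
    ultimately show ?thesis using * by metis
  qed
  show "frechet_derivative (\<lambda>x. frechet_derivative F (at x) v) (at z) w \<bullet> b =
    frechet_derivative (\<lambda>x. frechet_derivative F (at x) w) (at z) v \<bullet> b"
    using second_derivative_symmetric_real[OF S Fb, of v w] D by metis
qed


text \<open>Product rule for a one-form evaluated on a vector along the map J. The form is known to
  be differentiable only on fixed vectors, so the moving vector F is expanded in the basis.\<close>

lemma has_derivative_one_form:
  fixes a :: "'e::euclidean_space \<Rightarrow> 'e \<Rightarrow> real" and J F :: "'m::real_normed_vector \<Rightarrow> 'e"
  assumes U: "open U" "J z \<in> U"
    and lin: "\<And>u. u \<in> U \<Longrightarrow> linear (a u)"
    and diff: "\<And>b. (\<lambda>u. a u b) differentiable (at (J z))"
    and J: "(J has_derivative J') (at z)" and F: "(F has_derivative F') (at z)"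
  shows "((\<lambda>y. a (J y) (F y)) has_derivative
    (\<lambda>e. frechet_derivative (\<lambda>u. a u (F z)) (at (J z)) (J' e) + a (J z) (F' e))) (at z)"
proof -
  let ?D = "\<lambda>b. frechet_derivative (\<lambda>u. a u b) (at (J z))"
  note D = has_frechet_derivative[OF diff]
  have exp: "a u w = (\<Sum>b\<in>Basis. (w \<bullet> b) * a u b)" if "u \<in> U" for u w
    using linear_Basis_expansion[OF lin[OF that], of w] by simp
  \<comment> \<open>Differentiation in the base point preserves linearity in the vector
    slot.\<close>
  have Dexp: "?D w = (\<lambda>e. \<Sum>b\<in>Basis. (w \<bullet> b) * ?D b e)" for w
  proof (rule frechet_derivative_eq, rule has_derivative_transform_within_open[OF _ U])
    show "((\<lambda>u. \<Sum>b\<in>Basis. (w \<bullet> b) * a u b) has_derivative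
      (\<lambda>e. \<Sum>b\<in>Basis. (w \<bullet> b) * ?D b e)) (at (J z))"
      by (intro has_derivative_sum has_derivative_mult_right D)
  qed (use exp in auto)
  have "((\<lambda>y. \<Sum>b\<in>Basis. (F y \<bullet> b) * a (J y) b) has_derivative
      (\<lambda>e. \<Sum>b\<in>Basis. (F z \<bullet> b) * ?D b (J' e) + (F' e \<bullet> b) * a (J z) b)) (at z)"
    by (intro has_derivative_sum has_derivative_mult has_derivative_inner_left F
        has_derivative_compose[OF J D])
  then have "((\<lambda>y. \<Sum>b\<in>Basis. (F y \<bullet> b) * a (J y) b) has_derivative
      (\<lambda>e. ?D (F z) (J' e) + a (J z) (F' e))) (at z)"
    unfolding Dexp[of "F z"] exp[OF U(2), of "F' _"] by (simp add: sum.distrib)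
  \<comment> \<open>The form is known to be linear only over U; continuity of J makes the expansion
    valid near z.\<close>
  moreover have "\<forall>\<^sub>F y in at z. J y \<in> U"
    using has_derivative_continuous[OF J] U
    by (simp add: continuous_within topological_tendstoD)
  then have "\<forall>\<^sub>F y in at z. (\<Sum>b\<in>Basis. (F y \<bullet> b) * a (J y) b) = a (J y) (F y)"
    by eventually_elim (simp add: exp[symmetric])
  ultimately show ?thesis
    by (rule has_derivative_transform_eventually) (use exp[OF U(2), of "F z"] in auto)
qed


section \<open>Charts and tangent vectors\<close>

lemma cinv_cmap: "is_chart c \<Longrightarrow> p \<in> cdom c \<Longrightarrow> cinv c (cmap c p) = p"
  by (auto simp: is_chart_def homeomorphism_def)

lemma cmap_cinv: "u \<in> cmap c ` cdom c \<Longrightarrow> cmap c (cinv c u) = u"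
  by (rule f_inv_into_f)

lemma cinv_in_cdom: "u \<in> cmap c ` cdom c \<Longrightarrow> cinv c u \<in> cdom c"
  by (rule inv_into_into)

lemma cmap_image_iff:
  assumes "is_chart c"
  shows "u \<in> cmap c ` (cdom c \<inter> U) \<longleftrightarrow> u \<in> cmap c ` cdom c \<and> cinv c u \<in> U"
  using cinv_cmap[OF assms] by (auto intro!: rev_image_eqI)

lemma open_chart_image:
  assumes "is_chart c" "open U"
  shows "open (cmap c ` (cdom c \<inter> U))"
proof -
  have "continuous_on (cmap c ` cdom c) (cinv c)" "open (cmap c ` cdom c)"
    using assms(1) by (auto simp: is_chart_def homeomorphism_def)
  then have "open (cinv c -` U \<inter> cmap c ` cdom c)"
    using assms(2) continuous_on_open_vimage by blast
  moreover have "cinv c -` U \<inter> cmap c ` cdom c = cmap c ` (cdom c \<inter> U)"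
    using cmap_image_iff[OF assms(1)] by blast
  ultimately show ?thesis by simp
qed

lemma smooth_manifold_chart: "smooth_manifold A \<Longrightarrow> c \<in> A \<Longrightarrow> is_chart c"
  by (simp add: smooth_manifold_def)

lemma open_cdom: "smooth_manifold A \<Longrightarrow> c \<in> A \<Longrightarrow> open (cdom c)"
  by (simp add: smooth_manifold_def is_chart_def)

lemma open_chart_range: "smooth_manifold A \<Longrightarrow> c \<in> A \<Longrightarrow> open (cmap c ` cdom c)"
  by (simp add: smooth_manifold_def is_chart_def)

lemma open_chart_overlap:
  "smooth_manifold A \<Longrightarrow> c \<in> A \<Longrightarrow> d \<in> A \<Longrightarrow> open (cmap c ` (cdom c \<inter> cdom d))"
  by (simp add: open_chart_image smooth_manifold_chart open_cdom)

lemma chart_exists: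
  assumes "smooth_manifold A"
  obtains c where "c \<in> A" "p \<in> cdom c"
  using assms unfolding smooth_manifold_def by blast

lemma chart_at:
  assumes "smooth_manifold A"
  shows "chart_at A p \<in> A" "p \<in> cdom (chart_at A p)"
  using someI_ex[of "\<lambda>c. c \<in> A \<and> p \<in> cdom c"] chart_exists[OF assms, of p]
  unfolding chart_at_def by metis+

lemma transition_differentiable:
  assumes "smooth_manifold A" "c \<in> A" "d \<in> A" "p \<in> cdom c" "p \<in> cdom d"
  shows "(cmap d \<circ> cinv c) differentiable (at (cmap c p))"
  using assms by (intro smooth_onD_differentiable[of "cmap c ` (cdom c \<inter> cdom d)"])
    (auto simp: smooth_manifold_def)

text \<open>The chain rule through the transition maps, one direction for differentiability and the
  other for the identity. As h may be vector valued, this serves functions, charts and maps in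
  coordinates alike.\<close>

lemma change_of_chart:
  assumes A: "smooth_manifold A" and c: "c \<in> A" "p \<in> cdom c" and d: "d \<in> A" "p \<in> cdom d"
    and h: "(h \<circ> cinv c) differentiable (at (cmap c p))"
  shows "(h \<circ> cinv d) differentiable (at (cmap d p))" (is ?diff)
    and "frechet_derivative (h \<circ> cinv d) (at (cmap d p))
        (frechet_derivative (cmap d \<circ> cinv c) (at (cmap c p)) e) =
      frechet_derivative (h \<circ> cinv c) (at (cmap c p)) e"
proof -
  note ch = smooth_manifold_chart[OF A]
  note T = has_frechet_derivative[OF transition_differentiable[OF A]]
  have pd: "(cmap c \<circ> cinv d) (cmap d p) = cmap c p" and pc: "(cmap d \<circ> cinv c) (cmap c p) = cmap d p"
    using c d cinv_cmap[OF ch] by auto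
  have mem: "cmap d p \<in> cmap d ` (cdom d \<inter> cdom c)" "cmap c p \<in> cmap c ` (cdom c \<inter> cdom d)"
    using c d by auto
  have "((h \<circ> cinv c) \<circ> (cmap c \<circ> cinv d)) differentiable (at (cmap d p))"
    using h T[OF d(1) c(1) d(2) c(2)] pd
    by (intro differentiable_chain_at) (auto simp: differentiable_def)
  then show ?diff
    by (rule differentiable_cong_open[OF _ open_chart_overlap[OF A d(1) c(1)] mem(1)])
      (use c d cinv_cmap[OF ch[OF c(1)]] cinv_cmap[OF ch[OF d(1)]] in auto)
  note D = has_frechet_derivative[OF this]
  have "((h \<circ> cinv d) \<circ> (cmap d \<circ> cinv c) has_derivative
      frechet_derivative (h \<circ> cinv d) (at (cmap d p)) \<circ>
      frechet_derivative (cmap d \<circ> cinv c) (at (cmap c p))) (at (cmap c p))"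
    using D pc by (intro diff_chain_at T c d) simp
  then have "(h \<circ> cinv c has_derivative
      frechet_derivative (h \<circ> cinv d) (at (cmap d p)) \<circ>
      frechet_derivative (cmap d \<circ> cinv c) (at (cmap c p))) (at (cmap c p))"
    by (rule has_derivative_transform_within_open[OF _ open_chart_overlap[OF A c(1) d(1)] mem(2)])
      (use c d cinv_cmap[OF ch[OF c(1)]] cinv_cmap[OF ch[OF d(1)]] in auto)
  from frechet_derivative_eq[OF this]
  show "frechet_derivative (h \<circ> cinv d) (at (cmap d p))
        (frechet_derivative (cmap d \<circ> cinv c) (at (cmap c p)) e) =
      frechet_derivative (h \<circ> cinv c) (at (cmap c p)) e" by simp
qed

section \<open>Tangent vectors given by their components in one chart\<close>

lemma coord_vector_tangent:
  assumes A: "smooth_manifold A" and c: "c \<in> A" "p \<in> cdom c"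
  shows "coord_vector A c p e \<in> tangent_space A p"
  unfolding tangent_space_def mem_Collect_eq
proof (intro conjI ballI impI allI)
  fix d d' assume d: "d \<in> A" "d' \<in> A" "p \<in> cdom d \<inter> cdom d'"
  then show "coord_vector A c p e d' =
      frechet_derivative (cmap d' \<circ> cinv d) (at (cmap d p)) (coord_vector A c p e d)"
    using change_of_chart(2)[OF A c, of d "cmap d'" e] transition_differentiable[OF A c(1), of d' p] c
    by (simp add: coord_vector_def)
qed (auto simp: coord_vector_def)

lemma coord_vector_self:
  assumes A: "smooth_manifold A" and c: "c \<in> A" "p \<in> cdom c"
  shows "coord_vector A c p e c = e"
proof -
  have "(id has_derivative (\<lambda>v. v)) (at (cmap c p))" by (simp add: id_def)
  then have "(cmap c \<circ> cinv c has_derivative (\<lambda>v. v)) (at (cmap c p))"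
    by (rule has_derivative_transform_within_open[OF _ open_chart_range[OF A c(1)]])
      (use c cinv_cmap[OF smooth_manifold_chart[OF A c(1)]] in auto)
  from frechet_derivative_eq[OF this] show ?thesis
    using c by (simp add: coord_vector_def)
qed

lemma tangent_transform:
  "v \<in> tangent_space A p \<Longrightarrow> c \<in> A \<Longrightarrow> p \<in> cdom c \<Longrightarrow> d \<in> A \<Longrightarrow> p \<in> cdom d \<Longrightarrow>
    v d = frechet_derivative (cmap d \<circ> cinv c) (at (cmap c p)) (v c)"
  unfolding tangent_space_def by blast

text \<open>The transformation rule recovers all components from a single one, and the convention of
  0 outside the charts around p fixes the rest.\<close>

lemma tangent_eq_coord_vector:
  assumes "v \<in> tangent_space A p" "c \<in> A" "p \<in> cdom c"
  shows "v = coord_vector A c p (v c)"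
proof
  fix d show "v d = coord_vector A c p (v c) d"
  proof (cases "d \<in> A \<and> p \<in> cdom d")
    case True
    then have "v d = frechet_derivative (cmap d \<circ> cinv c) (at (cmap c p)) (v c)"
      by (intro tangent_transform[OF assms]) simp_all
    also have "\<dots> = coord_vector A c p (v c) d" unfolding coord_vector_def using True by (rule if_P[symmetric])
    finally show ?thesis .
  next
    case False
    then have "v d = 0" using assms unfolding tangent_space_def by blast
    also have "\<dots> = coord_vector A c p (v c) d" unfolding coord_vector_def using False by (rule if_not_P[symmetric])
    finally show ?thesis .
  qed
qed

lemma coord_vector_linear:
  assumes A: "smooth_manifold A" and c: "c \<in> A" "p \<in> cdom c"
  shows "coord_vector A c p (a *\<^sub>R e + b *\<^sub>R e') =
    a *\<^sub>R coord_vector A c p e + b *\<^sub>R coord_vector A c p e'"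
proof
  fix d
  show "coord_vector A c p (a *\<^sub>R e + b *\<^sub>R e') d =
    (a *\<^sub>R coord_vector A c p e + b *\<^sub>R coord_vector A c p e') d"
  proof (cases "d \<in> A \<and> p \<in> cdom d")
    case True
    then have "linear (frechet_derivative (cmap d \<circ> cinv c) (at (cmap c p)))"
      using transition_differentiable[OF A c(1) _ c(2)] linear_frechet_derivative by blast
    then show ?thesis
      by (simp add: coord_vector_def scaleR_fun_def linear_add linear_scale)
  qed (auto simp: coord_vector_def scaleR_fun_def)
qed

lemma tangent_space_lincomb:
  assumes A: "smooth_manifold A" and v: "v \<in> tangent_space A p" "w \<in> tangent_space A p"
  shows "a *\<^sub>R v + b *\<^sub>R w \<in> tangent_space A p"
proof -
  obtain c where c: "c \<in> A" "p \<in> cdom c" using chart_exists[OF A] .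
  have "a *\<^sub>R v + b *\<^sub>R w = coord_vector A c p (a *\<^sub>R v c + b *\<^sub>R w c)"
    using tangent_eq_coord_vector[OF _ c] v coord_vector_linear[OF A c] by metis
  then show ?thesis using coord_vector_tangent[OF A c] by simp
qed

lemma tangent_space_subspace:
  assumes A: "smooth_manifold A" shows "subspace (tangent_space A p)"
proof -
  obtain c where c: "c \<in> A" "p \<in> cdom c" using chart_exists[OF A] .
  note L = tangent_space_lincomb[OF A]
  have "0 \<in> tangent_space A p"
    using L[OF coord_vector_tangent[OF A c] coord_vector_tangent[OF A c], of 0 _ 0] by simp
  then show ?thesis
    using L[of _ p _ 1 1] L[where b = 0] unfolding subspace_def by fastforce
qed

section \<open>Derivatives of functions and maps in arbitrary charts\<close>

lemma vec_apply_eq: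
  assumes A: "smooth_manifold A" and c: "c \<in> A" "p \<in> cdom c" and v: "v \<in> tangent_space A p"
    and h: "(h \<circ> cinv c) differentiable (at (cmap c p))"
  shows "vec_apply A p v h = frechet_derivative (h \<circ> cinv c) (at (cmap c p)) (v c)"
proof -
  let ?d = "chart_at A p"
  have "v ?d = frechet_derivative (cmap ?d \<circ> cinv c) (at (cmap c p)) (v c)"
    by (rule tangent_transform[OF v c chart_at[OF A]])
  then show ?thesis
    using change_of_chart(2)[OF A c chart_at[OF A] h] by (simp add: vec_apply_def)
qed

lemma vec_apply_const: "vec_apply A p v (\<lambda>q. k) = 0"
  by (simp add: vec_apply_def o_def)

lemma differential_eq:
  assumes A: "smooth_manifold A" and c: "c \<in> A" "p \<in> cdom c" and v: "v \<in> tangent_space A p"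
    and d: "d \<in> A'" "h p \<in> cdom d"
    and h: "(cmap d \<circ> h \<circ> cinv c) differentiable (at (cmap c p))"
  shows "differential A A' h p v d = frechet_derivative (cmap d \<circ> h \<circ> cinv c) (at (cmap c p)) (v c)"
proof -
  let ?d = "chart_at A p"
  have "v ?d = frechet_derivative (cmap ?d \<circ> cinv c) (at (cmap c p)) (v c)"
    by (rule tangent_transform[OF v c chart_at[OF A]])
  then show ?thesis
    using change_of_chart(2)[OF A c chart_at[OF A] h] d by (simp add: differential_def)
qed

lemma smooth_map_differentiable:
  assumes "smooth_map A A' h" "c \<in> A" "p \<in> cdom c" "d \<in> A'" "h p \<in> cdom d"
  shows "(cmap d \<circ> h \<circ> cinv c) differentiable (at (cmap c p))"
  using assms by (intro smooth_onD_differentiable[of "cmap c ` (cdom c \<inter> h -` cdom d)"])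
    (auto simp: smooth_map_def)

lemma open_smooth_map_domain:
  assumes "smooth_manifold A" "smooth_manifold A'" "smooth_map A A' h" "c \<in> A" "d \<in> A'"
  shows "open (cmap c ` (cdom c \<inter> h -` cdom d))"
proof -
  have "open (h -` cdom d)"
    using assms open_cdom[OF assms(2,5)] by (auto simp: smooth_map_def intro: open_vimage)
  then show ?thesis by (rule open_chart_image[OF smooth_manifold_chart[OF assms(1,4)]])
qed

text \<open>Changing the chart in the target composes the coordinate map with a transition map, so
  the transformation rule is the chain rule.\<close>

lemma differential_tangent:
  assumes A: "smooth_manifold A" and A': "smooth_manifold A'" and h: "smooth_map A A' h"
    and v: "v \<in> tangent_space A p"
  shows "differential A A' h p v \<in> tangent_space A' (h p)"
  unfolding tangent_space_def mem_Collect_eq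
proof (intro conjI ballI impI allI)
  fix d d' assume d: "d \<in> A'" "d' \<in> A'" "h p \<in> cdom d \<inter> cdom d'"
  obtain c where c: "c \<in> A" "p \<in> cdom c" using chart_exists[OF A] .
  have hp: "h p \<in> cdom d" "h p \<in> cdom d'" using d by auto
  note cp = cinv_cmap[OF smooth_manifold_chart[OF A c(1)] c(2)]
  note diff = smooth_map_differentiable[OF h c]
  have "((cmap d' \<circ> cinv d) \<circ> (cmap d \<circ> h \<circ> cinv c) has_derivative
      frechet_derivative (cmap d' \<circ> cinv d) (at (cmap d (h p))) \<circ>
      frechet_derivative (cmap d \<circ> h \<circ> cinv c) (at (cmap c p))) (at (cmap c p))"
    using has_frechet_derivative[OF transition_differentiable[OF A' d(1,2) hp]] cp
    by (intro diff_chain_at has_frechet_derivative[OF diff] d hp) simp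
  then have "(cmap d' \<circ> h \<circ> cinv c has_derivative
      frechet_derivative (cmap d' \<circ> cinv d) (at (cmap d (h p))) \<circ>
      frechet_derivative (cmap d \<circ> h \<circ> cinv c) (at (cmap c p))) (at (cmap c p))"
    by (rule has_derivative_transform_within_open[OF _ open_smooth_map_domain[OF A A' h c(1) d(1)]])
      (use c hp cinv_cmap[OF smooth_manifold_chart[OF A c(1)]]
        cinv_cmap[OF smooth_manifold_chart[OF A' d(1)]] in auto)
  from frechet_derivative_eq[OF this]
  show "differential A A' h p v d' =
    frechet_derivative (cmap d' \<circ> cinv d) (at (cmap d (h p))) (differential A A' h p v d)"
    using differential_eq[OF A c v d(1) hp(1) diff[OF d(1) hp(1)]]
      differential_eq[OF A c v d(2) hp(2) diff[OF d(2) hp(2)]] by simp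
qed (auto simp: differential_def)

lemma differential_linear:
  assumes A: "smooth_manifold A" and h: "smooth_map A A' h"
  shows "differential A A' h p (a *\<^sub>R v + b *\<^sub>R w) =
    a *\<^sub>R differential A A' h p v + b *\<^sub>R differential A A' h p w"
proof
  fix d
  show "differential A A' h p (a *\<^sub>R v + b *\<^sub>R w) d =
    (a *\<^sub>R differential A A' h p v + b *\<^sub>R differential A A' h p w) d"
  proof (cases "d \<in> A' \<and> h p \<in> cdom d")
    case True
    then have "linear (frechet_derivative (cmap d \<circ> h \<circ> cinv (chart_at A p))
        (at (cmap (chart_at A p) p)))"
      using smooth_map_differentiable[OF h chart_at[OF A]] linear_frechet_derivative by blast
    then show ?thesis
      by (simp add: differential_def scaleR_fun_def linear_add linear_scale Let_def)
  qed (auto simp: differential_def scaleR_fun_def)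
qed


section \<open>Extending tangent vectors to vector fields\<close>

lemma vfield_smooth_on:
  "X \<in> vfields A \<Longrightarrow> c \<in> A \<Longrightarrow> smooth_on (cmap c ` cdom c) (\<lambda>u. X (cinv c u) c)"
  by (simp add: vfields_def smooth_vfield_on_def)

lemma vfields_tangent: "X \<in> vfields A \<Longrightarrow> X p \<in> tangent_space A p"
  by (simp add: vfields_def smooth_vfield_on_def)

lemma zero_vfield: "smooth_manifold A \<Longrightarrow> 0 \<in> vfields A"
  by (simp add: vfields_def smooth_vfield_on_def smooth_on_const subspace_0[OF tangent_space_subspace])

text \<open>The axioms of a connection speak only of global vector fields, hence a coordinate field
  is cut off by a bump function. The factor \<open>h\<close> remains in the formula and is divided
  out where the field is used.\<close>

lemma local_vfield_exists:
  fixes A :: "('a::{t2_space,second_countable_topology}, 'e::euclidean_space) chart set"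
  assumes A: "smooth_manifold A" and c: "c \<in> A" "p \<in> cdom c"
  obtains V h where "V \<in> vfields A" "smooth_on UNIV h" "h (cmap c p) > (0::real)"
    "\<And>u. u \<in> cmap c ` cdom c \<Longrightarrow> V (cinv c u) = h u *\<^sub>R coord_vector A c (cinv c u) e"
proof -
  note ch = smooth_manifold_chart[OF A]
  \<comment> \<open>A closed ball inside the chart image gives a set K that is compact, hence closed
    in the Hausdorff space; outside K the field is zero.\<close>
  obtain r where r: "r > 0" "cball (cmap c p) r \<subseteq> cmap c ` cdom c"
    using open_chart_range[OF A c(1)] c(2) open_contains_cball by blast
  obtain h :: "'e \<Rightarrow> real" where h: "smooth_on UNIV h" "h (cmap c p) > 0"
    and h0: "\<And>x. x \<notin> ball (cmap c p) r \<Longrightarrow> h x = 0"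
    using smooth_bump_exists[OF r(1)] by blast
  define K where "K = cinv c ` cball (cmap c p) r"
  define V where "V q = (if q \<in> cdom c then h (cmap c q) *\<^sub>R coord_vector A c q e else 0)" for q
  have "continuous_on (cball (cmap c p) r) (cinv c)"
    by (rule continuous_on_subset[OF _ r(2)])
      (use ch[OF c(1)] in \<open>simp add: is_chart_def homeomorphism_def\<close>)
  then have "closed K"
    unfolding K_def by (intro compact_imp_closed compact_continuous_image) auto
  then have oK: "open (- K)" by (simp add: open_Compl)
  have V0: "V q = 0" if "q \<notin> K" for q
  proof (cases "q \<in> cdom c")
    case True
    have "cmap c q \<notin> cball (cmap c p) r"
    proof
      assume "cmap c q \<in> cball (cmap c p) r"
      then have "cinv c (cmap c q) \<in> K" unfolding K_def by (rule imageI)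
      with that show False using cinv_cmap[OF ch[OF c(1)] True] by simp
    qed
    then show ?thesis using h0 by (simp add: V_def)
  qed (simp add: V_def)
  have "smooth_on (cmap d ` cdom d) (\<lambda>u. V (cinv d u) d)" if d: "d \<in> A" for d
  proof -
    \<comment> \<open>The overlap with c and the complement of K cover the domain of d. On the first
      the field has its coordinate formula, on the second it vanishes.\<close>
    let ?S1 = "cmap d ` (cdom d \<inter> cdom c)" and ?S2 = "cmap d ` (cdom d \<inter> - K)"
    let ?T = "cmap c ` (cdom c \<inter> cdom d)"
    have "K \<subseteq> cdom c"
      unfolding K_def by (intro image_subsetI cinv_in_cdom) (use r(2) in \<open>rule subsetD\<close>)
    then have "?S1 \<union> ?S2 = cmap d ` cdom d" by blast
    moreover have "smooth_on (?S1 \<union> ?S2) (\<lambda>u. V (cinv d u) d)"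
    proof (rule smooth_on_Un)
      show o1: "open ?S1" by (rule open_chart_overlap[OF A d c(1)])
      show o2: "open ?S2" by (rule open_chart_image[OF ch[OF d] oK])
      have t: "smooth_on ?S1 (cmap c \<circ> cinv d)" "smooth_on ?T (cmap d \<circ> cinv c)"
        using A c d by (auto simp: smooth_manifold_def)
      have sub: "(cmap c \<circ> cinv d) ` ?S1 \<subseteq> ?T"
        using cinv_cmap[OF ch[OF d]] by auto
      have "smooth_on ?S1 (\<lambda>u. h ((cmap c \<circ> cinv d) u) *\<^sub>R
        frechet_derivative (cmap d \<circ> cinv c) (at ((cmap c \<circ> cinv d) u)) e)"
        by (intro smooth_on_scaleR o1 smooth_on_compose[OF o1 t(1) h(1)]
            smooth_on_compose[OF o1 t(1) smooth_on_frechet_derivative[OF t(2)] sub]) auto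
      then show "smooth_on ?S1 (\<lambda>u. V (cinv d u) d)"
        by (rule smooth_on_cong[OF o1])
          (use d cinv_cmap[OF ch[OF d]] in
            \<open>auto simp: V_def coord_vector_def scaleR_fun_def\<close>)
      show "smooth_on ?S2 (\<lambda>u. V (cinv d u) d)"
        by (rule smooth_on_cong[OF o2 smooth_on_const[of _ 0]])
          (use V0 cinv_cmap[OF ch[OF d]] in auto)
    qed
    ultimately show ?thesis by simp
  qed
  moreover have "V q \<in> tangent_space A q" for q
    using tangent_space_subspace[OF A, of q] coord_vector_tangent[OF A c(1), of q]
    by (auto simp: V_def subspace_scale subspace_0)
  ultimately have "V \<in> vfields A" by (simp add: vfields_def smooth_vfield_on_def)
  moreover have "V (cinv c u) = h u *\<^sub>R coord_vector A c (cinv c u) e" if "u \<in> cmap c ` cdom c" for u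
    using cinv_in_cdom[OF that] cmap_cinv[OF that] by (simp add: V_def)
  ultimately show ?thesis using that h by blast
qed


section \<open>Riemannian metrics\<close>

lemma metric_lincomb_left:
  "riemannian_metric A g \<Longrightarrow> v \<in> tangent_space A p \<Longrightarrow> w \<in> tangent_space A p \<Longrightarrow>
    z \<in> tangent_space A p \<Longrightarrow> g p (a *\<^sub>R v + b *\<^sub>R w) z = a * g p v z + b * g p w z"
  unfolding riemannian_metric_def by blast

lemma metric_commute:
  "riemannian_metric A g \<Longrightarrow> v \<in> tangent_space A p \<Longrightarrow> w \<in> tangent_space A p \<Longrightarrow>
    g p v w = g p w v"
  unfolding riemannian_metric_def by blast

lemma metric_zero_left:
  assumes "riemannian_metric A g" "z \<in> tangent_space A p"
  shows "g p 0 z = 0"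
  using metric_lincomb_left[OF assms(1) assms(2) assms(2) assms(2), of 0 0] by simp

lemma metric_zero_right:
  assumes "riemannian_metric A g" "smooth_manifold A" "z \<in> tangent_space A p"
  shows "g p z 0 = 0"
  using metric_commute[OF assms(1) assms(3) subspace_0[OF tangent_space_subspace[OF assms(2)]]]
    metric_zero_left[OF assms(1,3)] by simp

lemma metric_pos: "riemannian_metric A g \<Longrightarrow> v \<in> tangent_space A p \<Longrightarrow> v \<noteq> 0 \<Longrightarrow> g p v v > 0"
  unfolding riemannian_metric_def by blast

lemma metric_cauchy_schwarz:
  assumes A: "smooth_manifold A" and g: "riemannian_metric A g"
    and v: "v \<in> tangent_space A p" and w: "w \<in> tangent_space A p"
  shows "(g p v w)\<^sup>2 \<le> g p v v * g p w w"
proof (cases "v = 0")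
  case True
  then show ?thesis using metric_zero_left[OF g] w v by simp
next
  case False
  note pos = metric_pos[OF g v False]
  \<comment> \<open>Up to the factor \<open>g p v v\<close>, z is the component of w orthogonal to
    v; its squared length is \<open>g p v v\<close> times the defect in the inequality.\<close>
  define z where "z = g p v v *\<^sub>R w + (- g p v w) *\<^sub>R v"
  have z: "z \<in> tangent_space A p" unfolding z_def by (rule tangent_space_lincomb[OF A w v])
  have gz: "g p z x = g p v v * g p w x + (- g p v w) * g p v x" if "x \<in> tangent_space A p" for x
    unfolding z_def by (rule metric_lincomb_left[OF g w v that])
  have "g p v z = g p z v" by (rule metric_commute[OF g v z])
  also have "\<dots> = 0"
    using gz[OF v] metric_commute[OF g v w] by simp
  finally have vz: "g p v z = 0" .
  have "g p w z = g p z w" by (rule metric_commute[OF g w z])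
  also have "\<dots> = g p v v * g p w w - (g p v w)\<^sup>2"
    using gz[OF w] by (simp add: power2_eq_square)
  finally have wz: "g p w z = g p v v * g p w w - (g p v w)\<^sup>2" .
  have "g p z z = g p v v * (g p v v * g p w w - (g p v w)\<^sup>2)"
    using gz[OF z] vz wz by simp
  moreover have "g p z z \<ge> 0"
    using metric_pos[OF g z] metric_zero_left[OF g z] by (cases "z = 0") auto
  ultimately show ?thesis using pos by (simp add: zero_le_mult_iff)
qed


section \<open>The characteristic vector field is geodesic\<close>

locale almost_contact_metric_manifold =
  fixes A :: "('n::{t2_space,second_countable_topology}, 'e::euclidean_space) chart set"
    and \<phi> :: "'n \<Rightarrow> ('n, 'e) tvec \<Rightarrow> ('n, 'e) tvec"
    and \<xi> :: "('n, 'e) vfield"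
    and \<eta> :: "'n \<Rightarrow> ('n, 'e) tvec \<Rightarrow> real"
    and g :: "('n, 'e) metric"
  assumes acm: "almost_contact_metric A \<phi> \<xi> \<eta> g"
begin

section \<open>Algebra of the structure tensors\<close>

lemma manifold: "smooth_manifold A"
  and metric: "riemannian_metric A g"
  and xi_vfield: "\<xi> \<in> vfields A"
  and eta_one_form: "one_form A \<eta>"
  and eta_xi: "\<eta> p (\<xi> p) = 1"
  using acm by (simp_all add: almost_contact_metric_def riemannian_manifold_def)

lemmas xi_tangent = vfields_tangent[OF xi_vfield]

lemma phi_tangent: "v \<in> tangent_space A p \<Longrightarrow> \<phi> p v \<in> tangent_space A p"
  and phi_lincomb: "v \<in> tangent_space A p \<Longrightarrow> w \<in> tangent_space A p \<Longrightarrow>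
    \<phi> p (a *\<^sub>R v + b *\<^sub>R w) = a *\<^sub>R \<phi> p v + b *\<^sub>R \<phi> p w"
  using acm unfolding almost_contact_metric_def endo_field_def by blast+

lemma phi_phi: "v \<in> tangent_space A p \<Longrightarrow> \<phi> p (\<phi> p v) = - v + \<eta> p v *\<^sub>R \<xi> p"
  and g_phi_phi: "v \<in> tangent_space A p \<Longrightarrow> w \<in> tangent_space A p \<Longrightarrow>
    g p (\<phi> p v) (\<phi> p w) = g p v w - \<eta> p v * \<eta> p w"
  using acm unfolding almost_contact_metric_def by blast+

lemma eta_lincomb: "v \<in> tangent_space A p \<Longrightarrow> w \<in> tangent_space A p \<Longrightarrow>
    \<eta> p (a *\<^sub>R v + b *\<^sub>R w) = a * \<eta> p v + b * \<eta> p w"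
  using eta_one_form unfolding one_form_def by blast

lemma phi_zero: "\<phi> p 0 = 0"
  using phi_lincomb[OF xi_tangent xi_tangent, of p 0 0] by simp

text \<open>The square of \<phi> kills \<xi>, so \<open>\<phi> p w = 0\<close> for w =
  \<open>\<phi> p (\<xi> p)\<close>. The formula for the square at w then makes w a multiple of
  \<xi>, and applying \<phi> once more forces w to be 0.\<close>

lemma phi_xi: "\<phi> p (\<xi> p) = 0"
proof -
  define w where "w = \<phi> p (\<xi> p)"
  have w: "w \<in> tangent_space A p" unfolding w_def by (intro phi_tangent xi_tangent)
  have "\<phi> p w = 0" using phi_phi[OF xi_tangent] eta_xi by (simp add: w_def)
  then have w_eq: "w = \<eta> p w *\<^sub>R \<xi> p" using phi_phi[OF w] phi_zero by simp
  have "\<phi> p (\<eta> p w *\<^sub>R \<xi> p) = \<eta> p w *\<^sub>R w"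
    using phi_lincomb[OF xi_tangent xi_tangent, of p "\<eta> p w" 0] by (simp add: w_def)
  then have "\<eta> p w *\<^sub>R w = 0" using \<open>\<phi> p w = 0\<close> w_eq by simp
  then have "w = 0" using w_eq by auto
  then show ?thesis by (simp add: w_def)
qed

text \<open>Compatibility of the metric with second argument \<xi>, where the left side vanishes
  because \<phi> \<xi> = 0.\<close>

lemma eta_eq: "v \<in> tangent_space A p \<Longrightarrow> \<eta> p v = g p v (\<xi> p)"
  using g_phi_phi[OF _ xi_tangent, of v p] eta_xi phi_xi
    metric_zero_right[OF metric manifold phi_tangent, of v p] by simp

lemma g_xi_xi: "g p (\<xi> p) (\<xi> p) = 1"
  using eta_eq[OF xi_tangent] eta_xi by simp

section \<open>The one-form \<eta> in coordinates\<close>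

definition eta_coord :: "('n, 'e) chart \<Rightarrow> 'e \<Rightarrow> 'e \<Rightarrow> real" where
  "eta_coord c u e = \<eta> (cinv c u) (coord_vector A c (cinv c u) e)"

lemma eta_coord_linear:
  assumes c: "c \<in> A" and u: "u \<in> cmap c ` cdom c"
  shows "linear (eta_coord c u)"
proof -
  have q: "cinv c u \<in> cdom c" by (rule cinv_in_cdom[OF u])
  have L: "eta_coord c u (a *\<^sub>R e + b *\<^sub>R e') = a * eta_coord c u e + b * eta_coord c u e'" for a b e e'
    unfolding eta_coord_def coord_vector_linear[OF manifold c q]
    by (intro eta_lincomb coord_vector_tangent[OF manifold c q])
  show ?thesis
    using L[of 1 _ 1] L[where b = 0] by (intro linearI) fastforce+
qed

lemma eta_coord_differentiable:
  "c \<in> A \<Longrightarrow> u \<in> cmap c ` cdom c \<Longrightarrow> (\<lambda>u. eta_coord c u e) differentiable (at u)"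
  using eta_one_form unfolding one_form_def eta_coord_def
  by (intro smooth_onD_differentiable[of "cmap c ` cdom c"]) auto

lemma eta_coord_eq:
  assumes "c \<in> A" "p \<in> cdom c" "v \<in> tangent_space A p"
  shows "eta_coord c (cmap c p) (v c) = \<eta> p v"
  using tangent_eq_coord_vector[OF assms(3,1,2)] cinv_cmap[OF smooth_manifold_chart[OF manifold assms(1)] assms(2)]
  by (simp add: eta_coord_def)

section \<open>The Levi-Civita connection and \<xi>\<close>

context
  fixes nab
  assumes lc: "levi_civita A g nab"
begin

lemma nab_vfield: "X \<in> vfields A \<Longrightarrow> Y \<in> vfields A \<Longrightarrow> nab X Y \<in> vfields A"
  using lc unfolding levi_civita_def affine_connection_def by blast

lemma nab_torsion_free:
  "X \<in> vfields A \<Longrightarrow> Y \<in> vfields A \<Longrightarrow> nab X Y - nab Y X = lie_bracket A X Y"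
  using lc unfolding levi_civita_def by blast

lemma nab_metric:
  "X \<in> vfields A \<Longrightarrow> Y \<in> vfields A \<Longrightarrow> Z \<in> vfields A \<Longrightarrow>
    vec_apply A p (X p) (\<lambda>q. g q (Y q) (Z q)) = g p (nab X Y p) (Z p) + g p (Y p) (nab X Z p)"
  using lc unfolding levi_civita_def by blast

lemma nab_zero:
  assumes "X \<in> vfields A" shows "nab X 0 = 0"
proof -
  have "nab X (0 + 0) = nab X 0 + nab X 0"
    using lc assms zero_vfield[OF manifold] unfolding levi_civita_def affine_connection_def by blast
  then show ?thesis by simp
qed

text \<open>\<xi> has constant length, so differentiating g(\<xi>, \<xi>) = 1 shows that twice this
  product is 0.\<close>

lemma g_nab_xi:
  assumes X: "X \<in> vfields A" shows "g p (\<xi> p) (nab X \<xi> p) = 0"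
proof -
  have "g p (nab X \<xi> p) (\<xi> p) = g p (\<xi> p) (nab X \<xi> p)"
    by (intro metric_commute[OF metric] vfields_tangent nab_vfield X xi_vfield)
  then show ?thesis
    using nab_metric[OF X xi_vfield xi_vfield, of p] g_xi_xi by (simp add: vec_apply_const)
qed

text \<open>All three conditions give (nabla_\<xi> \<phi>) \<xi> = 0: the two Sasakian terms cancel,
  and the Kenmotsu terms contain \<phi> \<xi> = 0. This puts nabla_\<xi> \<xi> in the kernel of
  \<phi>, while the constant length of \<xi> makes it orthogonal to \<xi>; only 0 satisfies
  both.\<close>

lemma nab_xi_xi:
  assumes "cosymplectic A \<phi> nab \<or> sasakian A \<phi> \<xi> \<eta> g nab \<or> kenmotsu A \<phi> \<xi> \<eta> g nab"
  shows "nab \<xi> \<xi> p = 0"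
proof -
  define n where "n = nab \<xi> \<xi> p"
  have n: "n \<in> tangent_space A p"
    unfolding n_def by (intro vfields_tangent nab_vfield xi_vfield)
  have "cov_endo nab \<phi> \<xi> \<xi> p = 0"
    using assms xi_vfield eta_xi g_xi_xi phi_xi
    by (auto simp: cosymplectic_def sasakian_def kenmotsu_def metric_zero_left[OF metric xi_tangent])
  moreover have "(\<lambda>q. \<phi> q (\<xi> q)) = 0" using phi_xi by (simp add: zero_fun_def)
  ultimately have "\<phi> p n = 0"
    by (simp add: cov_endo_def nab_zero[OF xi_vfield] n_def)
  moreover have "\<eta> p n = 0"
    using eta_eq[OF n] metric_commute[OF metric n xi_tangent] g_nab_xi[OF xi_vfield] by (simp add: n_def)
  ultimately show ?thesis using phi_phi[OF n] phi_zero by (simp add: n_def)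
qed

text \<open>As \<eta>(\<xi>) is constant, the equation says d\<eta>(\<xi>, V) = 0. Metric
  compatibility with nabla_\<xi> \<xi> = 0 gives g(\<xi>, nabla_\<xi> V) on the left; on the right
  the torsion-free bracket contributes the same, since nabla_V \<xi> is orthogonal to \<xi>.\<close>

lemma eta_lie_bracket_xi:
  assumes geo: "\<And>p. nab \<xi> \<xi> p = 0" and V: "V \<in> vfields A"
  shows "vec_apply A p (\<xi> p) (\<lambda>q. \<eta> q (V q)) = \<eta> p (lie_bracket A \<xi> V p)"
    and "lie_bracket A \<xi> V p \<in> tangent_space A p"
proof -
  note T = vfields_tangent[OF nab_vfield[OF xi_vfield V], of p]
    vfields_tangent[OF nab_vfield[OF V xi_vfield], of p]
  have L: "lie_bracket A \<xi> V p = 1 *\<^sub>R nab \<xi> V p + (- 1) *\<^sub>R nab V \<xi> p"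
    using nab_torsion_free[OF xi_vfield V, symmetric] by simp
  then show tan: "lie_bracket A \<xi> V p \<in> tangent_space A p"
    using tangent_space_lincomb[OF manifold T] by metis
  have "(\<lambda>q. \<eta> q (V q)) = (\<lambda>q. g q (\<xi> q) (V q))"
    using eta_eq[OF vfields_tangent[OF V]] metric_commute[OF metric vfields_tangent[OF V] xi_tangent]
    by (intro ext) simp
  then have "vec_apply A p (\<xi> p) (\<lambda>q. \<eta> q (V q)) = g p (\<xi> p) (nab \<xi> V p)"
    using nab_metric[OF xi_vfield xi_vfield V, of p] geo
      metric_zero_left[OF metric vfields_tangent[OF V]] by simp
  also have "\<dots> = g p (lie_bracket A \<xi> V p) (\<xi> p)"
    unfolding L metric_lincomb_left[OF metric T xi_tangent]
    using metric_commute[OF metric T(1) xi_tangent] metric_commute[OF metric T(2) xi_tangent]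
      g_nab_xi[OF V] by simp
  also have "\<dots> = \<eta> p (lie_bracket A \<xi> V p)" by (rule eta_eq[OF tan, symmetric])
  finally show "vec_apply A p (\<xi> p) (\<lambda>q. \<eta> q (V q)) = \<eta> p (lie_bracket A \<xi> V p)" .
qed

text \<open>In coordinates, \<open>d\<eta>(\<xi>, e) = 0\<close>.\<close>

lemma eta_coord_closed_xi:
  assumes geo: "\<And>p. nab \<xi> \<xi> p = 0" and c: "c \<in> A" "p \<in> cdom c"
  shows "frechet_derivative (\<lambda>u. eta_coord c u e) (at (cmap c p)) (\<xi> p c) =
    frechet_derivative (\<lambda>u. eta_coord c u (\<xi> p c)) (at (cmap c p)) e"
proof -
  let ?S = "cmap c ` cdom c" and ?u = "cmap c p" and ?a = "eta_coord c"
  let ?x = "\<lambda>u. \<xi> (cinv c u) c"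
  let ?Dx = "frechet_derivative ?x (at ?u)"
  have S: "open ?S" "?u \<in> ?S" using open_chart_range[OF manifold c(1)] c by auto
  have p: "cinv c ?u = p" by (rule cinv_cmap[OF smooth_manifold_chart[OF manifold c(1)] c(2)])
  note lin = eta_coord_linear[OF c(1)]
  note diff = eta_coord_differentiable[OF c(1)]
  have dx: "(?x has_derivative ?Dx) (at ?u)"
    by (intro has_frechet_derivative smooth_onD_differentiable[OF vfield_smooth_on[OF xi_vfield c(1)]] S)
  \<comment> \<open>V stands in for the constant coordinate field e, which exists only inside the
    chart.\<close>
  obtain V h where V: "V \<in> vfields A" and h: "smooth_on UNIV h" "h ?u > (0::real)"
    and Vh: "\<And>u. u \<in> ?S \<Longrightarrow> V (cinv c u) = h u *\<^sub>R coord_vector A c (cinv c u) e"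
    using local_vfield_exists[OF manifold c, of e] by blast
  let ?Dh = "frechet_derivative h (at ?u)"
  have dh: "(h has_derivative ?Dh) (at ?u)"
    by (intro has_frechet_derivative smooth_onD_differentiable[OF h(1)]) simp
  have D1: "((\<lambda>u. ?a u (?x u)) has_derivative
      (\<lambda>w. frechet_derivative (\<lambda>u. ?a u (?x ?u)) (at ?u) w + ?a ?u (?Dx w))) (at ?u)"
    by (rule has_derivative_one_form[of ?S "\<lambda>u. u", OF S _ _ _ dx])
      (use lin diff S in \<open>auto intro: has_derivative_ident\<close>)
  have "?a u (?x u) = 1" if "u \<in> ?S" for u
    using eta_coord_eq[OF c(1) cinv_in_cdom[OF that] xi_tangent] cmap_cinv[OF that] eta_xi by simp
  then have D2: "((\<lambda>u. ?a u (?x u)) has_derivative (\<lambda>w. 0)) (at ?u)"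
    by (intro has_derivative_transform_within_open[OF has_derivative_const[of 1] S]) simp
  \<comment> \<open>Differentiating \<eta>(\<xi>) = 1 in coordinates trades the derivative of the
    form on \<xi> for the form on the derivative of \<xi>.\<close>
  have 1: "frechet_derivative (\<lambda>u. ?a u (\<xi> p c)) (at ?u) w + ?a ?u (?Dx w) = 0" for w
    using fun_cong[OF has_derivative_unique[OF D1 D2], of w] p by simp
  let ?De = "frechet_derivative (\<lambda>u. ?a u e) (at ?u)"
  have "((\<lambda>u. h u * ?a u e) has_derivative (\<lambda>w. h ?u * ?De w + ?Dh w * ?a ?u e)) (at ?u)"
    by (intro has_derivative_mult dh has_frechet_derivative diff S)
  then have D\<eta>: "((\<lambda>q. \<eta> q (V q)) \<circ> cinv c has_derivative
      (\<lambda>w. h ?u * ?De w + ?Dh w * ?a ?u e)) (at ?u)"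
  proof (rule has_derivative_transform_within_open[OF _ S])
    fix u assume u: "u \<in> ?S"
    note ct = coord_vector_tangent[OF manifold c(1) cinv_in_cdom[OF u]]
    show "h u * ?a u e = ((\<lambda>q. \<eta> q (V q)) \<circ> cinv c) u"
      using eta_lincomb[OF ct ct, of "h u" e 0 e] by (simp add: Vh[OF u] eta_coord_def)
  qed
  have 2: "vec_apply A p (\<xi> p) (\<lambda>q. \<eta> q (V q)) = h ?u * ?De (\<xi> p c) + ?Dh (\<xi> p c) * ?a ?u e"
    using vec_apply_eq[OF manifold c xi_tangent, of "\<lambda>q. \<eta> q (V q)"] D\<eta> frechet_derivative_eq[OF D\<eta>]
    by (auto simp: differentiable_def)
  have "((\<lambda>u. h u *\<^sub>R e) has_derivative (\<lambda>w. ?Dh w *\<^sub>R e)) (at ?u)"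
    by (rule has_derivative_scaleR_left[OF dh])
  then have DV: "((\<lambda>u. V (cinv c u) c) has_derivative (\<lambda>w. ?Dh w *\<^sub>R e)) (at ?u)"
  proof (rule has_derivative_transform_within_open[OF _ S])
    fix u assume u: "u \<in> ?S"
    show "h u *\<^sub>R e = V (cinv c u) c"
      using coord_vector_self[OF manifold c(1) cinv_in_cdom[OF u]] by (simp add: Vh[OF u] scaleR_fun_def)
  qed
  have "V p c = h ?u *\<^sub>R e"
    using Vh[OF S(2)] coord_vector_self[OF manifold c] p by (simp add: scaleR_fun_def)
  then have "lie_bracket A \<xi> V p c = ?Dh (\<xi> p c) *\<^sub>R e - h ?u *\<^sub>R ?Dx e"
    using c linear_scale[OF has_derivative_linear[OF dx]]
    by (simp add: lie_bracket_def frechet_derivative_eq[OF DV])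
  then have "\<eta> p (lie_bracket A \<xi> V p) = ?Dh (\<xi> p c) * ?a ?u e - h ?u * ?a ?u (?Dx e)"
    using eta_coord_eq[OF c eta_lie_bracket_xi(2)[OF geo V]] linear_diff[OF lin[OF S(2)]]
      linear_scale[OF lin[OF S(2)]] by simp
  \<comment> \<open>The terms with the derivative of h occur on both sides and cancel; what is left
    is proportional to h, which is positive at the point.\<close>
  then have "h ?u * ?De (\<xi> p c) = h ?u * (- ?a ?u (?Dx e))"
    using eta_lie_bracket_xi(1)[OF geo V, of p] 2 by simp
  then have "?De (\<xi> p c) = - ?a ?u (?Dx e)"
    by (rule mult_left_cancel[THEN iffD1, rotated]) (use h(2) in simp)
  then show ?thesis using 1[of e] by simp
qed

end

end


section \<open>Product charts\<close>

abbreviation prod_chart :: "('b, 'k) chart \<Rightarrow> ('f, 'l) chart \<Rightarrow> ('b \<times> 'f, 'k \<times> 'l) chart" where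
  "prod_chart c d \<equiv> (cdom c \<times> cdom d, map_prod (cmap c) (cmap d))"

locale product_manifold =
  fixes B :: "('b::{t2_space,second_countable_topology}, 'k::euclidean_space) chart set"
    and F :: "('f::{t2_space,second_countable_topology}, 'l::euclidean_space) chart set"
  assumes base: "smooth_manifold B" and fibre: "smooth_manifold F"
    and prod: "smooth_manifold (prod_atlas B F)"
begin

lemma prod_chart_in_atlas: "c \<in> B \<Longrightarrow> d \<in> F \<Longrightarrow> prod_chart c d \<in> prod_atlas B F"
  unfolding prod_atlas_def by blast

lemma cinv_prod_chart:
  assumes "c \<in> B" "d \<in> F" "x \<in> cmap c ` cdom c" "y \<in> cmap d ` cdom d"
  shows "cinv (prod_chart c d) (x, y) = (cinv c x, cinv d y)"
proof -
  have "cinv (prod_chart c d) (cmap (prod_chart c d) (cinv c x, cinv d y)) = (cinv c x, cinv d y)"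
    by (rule cinv_cmap[OF smooth_manifold_chart[OF prod prod_chart_in_atlas[OF assms(1,2)]]])
      (use cinv_in_cdom[OF assms(3)] cinv_in_cdom[OF assms(4)] in simp)
  then show ?thesis using cmap_cinv[OF assms(3)] cmap_cinv[OF assms(4)] by simp
qed

lemma open_prod_chart_range:
  assumes "c \<in> B" "d \<in> F"
  shows "open (cmap c ` cdom c \<times> cmap d ` cdom d)"
  by (intro open_Times open_chart_range[OF base assms(1)] open_chart_range[OF fibre assms(2)])

context
  fixes c :: "('b, 'k) chart" and d :: "('f, 'l) chart" and b :: 'b and y :: 'f
  assumes c: "c \<in> B" "b \<in> cdom c" and d: "d \<in> F" "y \<in> cdom d"
begin

lemma differential_fibre_inclusion:
  assumes v: "v \<in> tangent_space F y"
  shows "differential F (prod_atlas B F) (\<lambda>y. (b, y)) y v (prod_chart c d) = (0, v d)"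
proof -
  have "((\<lambda>u. (cmap c b, u)) has_derivative (\<lambda>w. (0, w))) (at (cmap d y))"
    by (auto intro!: derivative_eq_intros)
  then have D: "(cmap (prod_chart c d) \<circ> (\<lambda>y. (b, y)) \<circ> cinv d has_derivative (\<lambda>w. (0, w)))
      (at (cmap d y))"
    by (rule has_derivative_transform_within_open[OF _ open_chart_range[OF fibre d(1)]])
      (use d cinv_cmap[OF smooth_manifold_chart[OF fibre d(1)]] in auto)
  show ?thesis
    using differential_eq[OF fibre d v prod_chart_in_atlas[OF c(1) d(1)], of "\<lambda>y. (b, y)"] D c d
      frechet_derivative_eq[OF D] by (auto simp: differentiable_def)
qed

text \<open>In a product chart the projection is \<open>fst\<close>; writing the result as a
  coordinate vector covers all charts of the base at once.\<close>

lemma differential_fst: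
  assumes v: "v \<in> tangent_space (prod_atlas B F) (b, y)"
  shows "differential (prod_atlas B F) B fst (b, y) v = coord_vector B c b (fst (v (prod_chart c d)))"
proof
  fix e :: "('b, 'k) chart"
  let ?P = "prod_chart c d"
  let ?D = "frechet_derivative (cmap e \<circ> cinv c) (at (cmap c b))"
  show "differential (prod_atlas B F) B fst (b, y) v e = coord_vector B c b (fst (v ?P)) e"
  proof (cases "e \<in> B \<and> b \<in> cdom e")
    case True
    then have De: "(cmap e \<circ> cinv c has_derivative ?D) (at (cmap c b))"
      using c by (intro has_frechet_derivative transition_differentiable[OF base]) auto
    have "((\<lambda>z. (cmap e \<circ> cinv c) (fst z)) has_derivative (\<lambda>w. ?D (fst w))) (at (cmap c b, cmap d y))"
      by (rule has_derivative_compose[OF has_derivative_fst[OF has_derivative_ident]])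
        (use De in \<open>simp only: fst_conv snd_conv\<close>)
    then have D: "(cmap e \<circ> fst \<circ> cinv ?P has_derivative (\<lambda>w. ?D (fst w))) (at (cmap c b, cmap d y))"
      by (rule has_derivative_transform_within_open[OF _ open_prod_chart_range[OF c(1) d(1)]])
        (use c d in \<open>auto simp del: split_paired_All simp: cinv_prod_chart[OF c(1) d(1), simplified]\<close>)
    show ?thesis
      using differential_eq[OF prod prod_chart_in_atlas[OF c(1) d(1)] _ v, of e B fst] D c d True
        frechet_derivative_eq[OF D] by (auto simp: differentiable_def coord_vector_def)
  qed (auto simp: differential_def coord_vector_def)
qed

lemma differential_snd:
  assumes v: "v \<in> tangent_space (prod_atlas B F) (b, y)"
  shows "differential (prod_atlas B F) F snd (b, y) v = coord_vector F d y (snd (v (prod_chart c d)))"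
proof
  fix e :: "('f, 'l) chart"
  let ?P = "prod_chart c d"
  let ?D = "frechet_derivative (cmap e \<circ> cinv d) (at (cmap d y))"
  show "differential (prod_atlas B F) F snd (b, y) v e = coord_vector F d y (snd (v ?P)) e"
  proof (cases "e \<in> F \<and> y \<in> cdom e")
    case True
    then have De: "(cmap e \<circ> cinv d has_derivative ?D) (at (cmap d y))"
      using d by (intro has_frechet_derivative transition_differentiable[OF fibre]) auto
    have "((\<lambda>z. (cmap e \<circ> cinv d) (snd z)) has_derivative (\<lambda>w. ?D (snd w))) (at (cmap c b, cmap d y))"
      by (rule has_derivative_compose[OF has_derivative_snd[OF has_derivative_ident]])
        (use De in \<open>simp only: fst_conv snd_conv\<close>)
    then have D: "(cmap e \<circ> snd \<circ> cinv ?P has_derivative (\<lambda>w. ?D (snd w))) (at (cmap c b, cmap d y))"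
      by (rule has_derivative_transform_within_open[OF _ open_prod_chart_range[OF c(1) d(1)]])
        (use c d in \<open>auto simp del: split_paired_All simp: cinv_prod_chart[OF c(1) d(1), simplified]\<close>)
    show ?thesis
      using differential_eq[OF prod prod_chart_in_atlas[OF c(1) d(1)] _ v, of e F snd] D c d True
        frechet_derivative_eq[OF D] by (auto simp: differentiable_def coord_vector_def)
  qed (auto simp: differential_def coord_vector_def)
qed

lemma fibre_bundle_component:
  assumes "v \<in> fibre_bundle B F (b, y)"
  shows "fst (v (prod_chart c d)) = 0"
  using assms differential_fibre_inclusion unfolding fibre_bundle_def by fastforce

text \<open>A vector tangent to the fibre has no base component in the product chart, so one such
  argument removes the \<open>g\<^sub>B\<close> summand.\<close>

lemma warped_metric_fibre:
  assumes gB: "riemannian_metric B g\<^sub>B"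
    and v: "v \<in> tangent_space (prod_atlas B F) (b, y)"
    and w: "w \<in> tangent_space (prod_atlas B F) (b, y)" "fst (w (prod_chart c d)) = 0"
  shows "warped_metric B g\<^sub>B F g\<^sub>F f (b, y) v w = (f b)\<^sup>2 *
    g\<^sub>F y (coord_vector F d y (snd (v (prod_chart c d)))) (coord_vector F d y (snd (w (prod_chart c d))))"
proof -
  have "coord_vector B c b 0 = 0"
    using coord_vector_linear[OF base c, of 0 0 0 0] by simp
  then show ?thesis
    using metric_zero_right[OF gB base coord_vector_tangent[OF base c]] w
    by (simp add: warped_metric_def Let_def differential_fst[OF v] differential_fst[OF w(1)]
        differential_snd[OF v] differential_snd[OF w(1)])
qed

end

end


section \<open>The characteristic vector field of a proper semi-slant submanifold\<close>

lemma (in almost_contact_metric_manifold) xi_in_invariant_distribution: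
  assumes ss: "pointwise_semi_slant M A \<iota> \<phi> g D1 D2 \<theta>" and proper: "proper_semi_slant \<theta>"
    and tan: "tangent_to_submanifold M A \<iota> \<xi>"
  obtains v where "v \<in> D1 p" "v \<in> tangent_space M p" "\<xi> (\<iota> p) = differential M A \<iota> p v"
proof -
  let ?d = "differential M A \<iota> p" and ?G = "g (\<iota> p)"
  note ss' = ss[unfolded pointwise_semi_slant_def immersion_def]
  have M: "smooth_manifold M" using ss' by (elim conjE)
  have im: "smooth_map M A \<iota>" using ss' by (elim conjE)
  have inj: "inj_on ?d (tangent_space M p)"
    using ss' by (elim conjE allE[of _ p])
  have D2: "D2 p = {w \<in> tangent_space M p. \<forall>v\<in>D1 p. induced_metric M A \<iota> g p v w = 0}"
    using ss' by (elim conjE allE[of _ p])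
  have int: "D1 p \<inter> D2 p = {0}"
    using ss' by (elim conjE allE[of _ p])
  have sum: "{v + w | v w. v \<in> D1 p \<and> w \<in> D2 p} = tangent_space M p"
    using ss' by (elim conjE allE[of _ p])
  have inv: "\<forall>v\<in>D1 p. \<phi> (\<iota> p) (?d v) \<in> ?d ` D1 p"
    using ss' by (elim conjE allE[of _ p])
  have slant: "\<forall>w\<in>D2 p. w \<noteq> 0 \<longrightarrow> \<phi> (\<iota> p) (?d w) \<noteq> 0 \<and>
      subspace_angle ?G (\<phi> (\<iota> p) (?d w)) (?d ` D2 p) = \<theta> p"
    using ss' by (elim conjE allE[of _ p])
  have T1: "v \<in> tangent_space M p" if "v \<in> D1 p" for v
  proof -
    have "v + 0 \<in> tangent_space M p" unfolding sum[symmetric] using int that by blast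
    then show ?thesis by simp
  qed
  have T2: "w \<in> tangent_space M p" if "w \<in> D2 p" for w using that D2 by blast
  note dT = differential_tangent[OF M manifold im]
  have d0: "?d 0 = 0" using differential_linear[OF M im, where a = 0 and b = 0] by simp
  obtain x where "x \<in> tangent_space M p" and x: "\<xi> (\<iota> p) = ?d x"
    using tan unfolding tangent_to_submanifold_def by blast
  then obtain v w where vw: "v \<in> D1 p" "w \<in> D2 p" "x = v + w" using sum by blast
  have dx: "?d x = ?d v + ?d w"
    using differential_linear[OF M im, where a = 1 and b = 1] vw(3) by simp
  have "w = 0"
  proof (rule ccontr)
    assume w0: "w \<noteq> 0"
    have "\<phi> (\<iota> p) (1 *\<^sub>R ?d v + 1 *\<^sub>R ?d w) = 1 *\<^sub>R \<phi> (\<iota> p) (?d v) + 1 *\<^sub>R \<phi> (\<iota> p) (?d w)"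
      by (intro phi_lincomb dT T1 T2 vw)
    \<comment> \<open>\<phi> \<xi> = 0 shifts \<phi> of the \<open>D2\<close> part onto the
      \<open>D1\<close> part, where invariance of \<open>D1\<close> takes over.\<close>
    then have "\<phi> (\<iota> p) (?d w) = - \<phi> (\<iota> p) (?d v)"
      using phi_xi[of "\<iota> p"] x dx by (simp add: eq_neg_iff_add_eq_0 add.commute)
    moreover obtain u where u: "u \<in> D1 p" "\<phi> (\<iota> p) (?d v) = ?d u" using inv vw(1) by blast
    ultimately have phi_w: "\<phi> (\<iota> p) (?d w) = (- 1) *\<^sub>R ?d u + 0 *\<^sub>R ?d u" by simp
    have orth: "?G (\<phi> (\<iota> p) (?d w)) (?d z) = 0" if "z \<in> D2 p" for z
    proof -
      have "?G (?d u) (?d z) = 0" using D2 that u(1) by (simp add: induced_metric_def)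
      then show ?thesis
        unfolding phi_w metric_lincomb_left[OF metric dT[OF T1[OF u(1)]] dT[OF T1[OF u(1)]]
            dT[OF T2[OF that]]] by simp
    qed
    \<comment> \<open>K is the angle whose infimum defines \<open>subspace_angle\<close>. By
      orthogonality it is constantly arccos 0, so the infimum is over a one-point set.\<close>
    define K where "K z = arccos (?G (\<phi> (\<iota> p) (?d w)) z /
      (sqrt (?G (\<phi> (\<iota> p) (?d w)) (\<phi> (\<iota> p) (?d w))) * sqrt (?G z z)))" for z
    have K: "K z = pi / 2" if "z \<in> ?d ` D2 p" for z using that orth by (auto simp: K_def)
    \<comment> \<open>This keeps the set of angles nonempty; the infimum of the empty set would be
      an unspecified value.\<close>
    have "?d w \<noteq> 0"
    proof
      assume "?d w = 0"
      then have "w = 0"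
        by (intro inj_onD[OF inj]) (use d0 T2 vw(2) subspace_0[OF tangent_space_subspace[OF M]] in auto)
      with w0 show False ..
    qed
    then have "?d w \<in> ?d ` D2 p \<and> ?d w \<noteq> 0" using vw(2) by blast
    then have "{K z | z. z \<in> ?d ` D2 p \<and> z \<noteq> 0} = {pi / 2}" using K by fastforce
    then have "subspace_angle ?G (\<phi> (\<iota> p) (?d w)) (?d ` D2 p) = pi / 2"
      unfolding subspace_angle_def K_def by simp
    then show False using slant vw(2) w0 proper unfolding proper_semi_slant_def by (metis less_irrefl)
  qed
  then show ?thesis using that vw(1) T1 x vw(3) by simp
qed


section \<open>The warping function\<close>

text \<open>Inside the locale the angle and the distributions have disappeared; what is left of them
  is that \<xi> comes from a vector along the fibre.\<close>

locale fibre_tangent_submanifold =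
  almost_contact_metric_manifold A \<phi> \<xi> \<eta> g + product_manifold B F
  for A :: "('n::{t2_space,second_countable_topology}, 'e::euclidean_space) chart set"
    and \<phi> \<xi> \<eta> g
    and B :: "('b::{t2_space,second_countable_topology}, 'k::euclidean_space) chart set"
    and F :: "('f::{t2_space,second_countable_topology}, 'l::euclidean_space) chart set" +
  fixes \<iota> :: "'b \<times> 'f \<Rightarrow> 'n" and g\<^sub>B :: "('b, 'k) metric" and g\<^sub>F :: "('f, 'l) metric"
    and f :: "'b \<Rightarrow> real"
  assumes warped: "warped_product_submanifold B g\<^sub>B F g\<^sub>F f A g \<iota>"
    and fibre_tangent: "\<And>p. \<exists>v. v \<in> fibre_bundle B F p \<and> v \<in> tangent_space (prod_atlas B F) p \<and>
      \<xi> (\<iota> p) = differential (prod_atlas B F) A \<iota> p v"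
begin

abbreviation "M \<equiv> prod_atlas B F"

lemma base_metric: "riemannian_metric B g\<^sub>B"
  and fibre_metric: "riemannian_metric F g\<^sub>F"
  and warping_smooth: "smooth_function B f"
  and warping_pos: "f b > 0"
  and immersion_smooth: "smooth_map M A \<iota>"
  using warped by (simp_all add: warped_product_submanifold_def riemannian_manifold_def immersion_def)

lemma induced_eq_warped:
  "v \<in> tangent_space M p \<Longrightarrow> w \<in> tangent_space M p \<Longrightarrow>
    induced_metric M A \<iota> g p v w = warped_metric B g\<^sub>B F g\<^sub>F f p v w"
  using warped unfolding warped_product_submanifold_def by blast

text \<open>A choice made point by point, with no claim of smoothness: it is evaluated but never
  differentiated below.\<close>

definition xi_lift :: "'b \<times> 'f \<Rightarrow> ('b \<times> 'f, 'k \<times> 'l) tvec" where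
  "xi_lift p = (SOME v. v \<in> fibre_bundle B F p \<and> v \<in> tangent_space M p \<and>
    \<xi> (\<iota> p) = differential M A \<iota> p v)"

lemma xi_lift_fibre: "xi_lift p \<in> fibre_bundle B F p"
  and xi_lift_tangent: "xi_lift p \<in> tangent_space M p"
  and differential_xi_lift: "differential M A \<iota> p (xi_lift p) = \<xi> (\<iota> p)"
  using someI_ex[OF fibre_tangent[of p]] unfolding xi_lift_def[symmetric] by auto

context
  fixes c :: "('b, 'k) chart" and d :: "('f, 'l) chart"
  assumes c: "c \<in> B" and d: "d \<in> F"
begin

abbreviation (input) "P \<equiv> prod_chart c d"

text \<open>\<eta> is dual to \<xi>, so its pullback pairs v with the lift of \<xi> in the warped
  metric; as the lift is along the fibre, only the fibre summand survives.\<close>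

lemma eta_differential:
  assumes b: "b \<in> cdom c" and y: "y \<in> cdom d" and v: "v \<in> tangent_space M (b, y)"
  shows "\<eta> (\<iota> (b, y)) (differential M A \<iota> (b, y) v) =
    (f b)\<^sup>2 * g\<^sub>F y (coord_vector F d y (snd (v P))) (coord_vector F d y (snd (xi_lift (b, y) P)))"
proof -
  have "\<eta> (\<iota> (b, y)) (differential M A \<iota> (b, y) v) = induced_metric M A \<iota> g (b, y) v (xi_lift (b, y))"
    by (simp add: eta_eq differential_tangent[OF prod manifold immersion_smooth v]
        induced_metric_def differential_xi_lift)
  also have "\<dots> = warped_metric B g\<^sub>B F g\<^sub>F f (b, y) v (xi_lift (b, y))"
    by (rule induced_eq_warped[OF v xi_lift_tangent])
  also have "\<dots> = (f b)\<^sup>2 *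
      g\<^sub>F y (coord_vector F d y (snd (v P))) (coord_vector F d y (snd (xi_lift (b, y) P)))"
    by (rule warped_metric_fibre[OF c b d y base_metric v xi_lift_tangent
          fibre_bundle_component[OF c b d y xi_lift_fibre]])
  finally show ?thesis .
qed

lemma warping_critical:
  assumes closed: "\<And>a p e. a \<in> A \<Longrightarrow> p \<in> cdom a \<Longrightarrow>
      frechet_derivative (\<lambda>u. eta_coord a u e) (at (cmap a p)) (\<xi> p a) =
      frechet_derivative (\<lambda>u. eta_coord a u (\<xi> p a)) (at (cmap a p)) e"
    and b: "b \<in> cdom c" and y: "y \<in> cdom d"
  shows "((f \<circ> cinv c) has_derivative (\<lambda>_. 0)) (at (cmap c b))"
proof -
  let ?x = "cmap c b" and ?y = "cmap d y" and ?\<iota> = "\<iota> (b, y)"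
  let ?z = "(?x, ?y)"
  note P = prod_chart_in_atlas[OF c d]
  obtain a where a: "a \<in> A" "?\<iota> \<in> cdom a" using chart_exists[OF manifold] .
  \<comment> \<open>J is \<iota> in coordinates, and S is the part of the image of the chart P that
    it sends into the domain of a.\<close>
  define S where "S = cmap P ` (cdom P \<inter> \<iota> -` cdom a)"
  define J where "J = cmap a \<circ> \<iota> \<circ> cinv P"
  define DJ where "DJ z v = frechet_derivative J (at z) v" for z v
  have S: "open S"
    unfolding S_def by (rule open_smooth_map_domain[OF prod manifold immersion_smooth P a(1)])
  have z: "?z \<in> S" unfolding S_def using b y a(2) by force
  have J: "smooth_on S J"
    using immersion_smooth P a(1) unfolding smooth_map_def S_def J_def by blast
  have Jz: "J ?z = cmap a ?\<iota>"
    using b y cinv_prod_chart[OF c d, of ?x ?y] cinv_cmap[OF smooth_manifold_chart[OF base c] b]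
      cinv_cmap[OF smooth_manifold_chart[OF fibre d] y] by (simp add: J_def)

  define \<zeta> where "\<zeta> p = snd (xi_lift p P)" for p
  have xi_lift_P: "xi_lift (b', y') P = (0, \<zeta> (b', y'))" if "b' \<in> cdom c" "y' \<in> cdom d" for b' y'
    using fibre_bundle_component[OF c that(1) d that(2) xi_lift_fibre] by (simp add: \<zeta>_def prod_eq_iff)
  define H where "H y' l l' = g\<^sub>F y' (coord_vector F d y' l) (coord_vector F d y' l')" for y' l l'
  \<comment> \<open>The pullback \<alpha> of \<eta> in coordinates. A base vector has l = 0, so
    \<alpha> vanishes on it.\<close>
  have pullback: "eta_coord a (J (cmap c b', cmap d y')) (DJ (cmap c b', cmap d y') (k, l)) =
      (f b')\<^sup>2 * H y' l (\<zeta> (b', y'))"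
    if q: "b' \<in> cdom c" "y' \<in> cdom d" "\<iota> (b', y') \<in> cdom a" for b' y' k l
  proof -
    have qP: "(b', y') \<in> cdom P" "cmap P (b', y') = (cmap c b', cmap d y')" using q by auto
    have Jq: "J (cmap c b', cmap d y') = cmap a (\<iota> (b', y'))"
      using cinv_cmap[OF smooth_manifold_chart[OF prod P] qP(1)] by (simp add: J_def)
    note v = coord_vector_tangent[OF prod P qP(1), of "(k, l)"]
    have "differential M A \<iota> (b', y') (coord_vector M P (b', y') (k, l)) a =
        DJ (cmap c b', cmap d y') (k, l)"
      using differential_eq[OF prod P qP(1) v a(1) q(3)
          smooth_map_differentiable[OF immersion_smooth P qP(1) a(1) q(3)]]
      by (simp add: DJ_def J_def coord_vector_self[OF prod P qP(1)])
    then have "eta_coord a (J (cmap c b', cmap d y')) (DJ (cmap c b', cmap d y') (k, l)) =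
        \<eta> (\<iota> (b', y')) (differential M A \<iota> (b', y') (coord_vector M P (b', y') (k, l)))"
      using eta_coord_eq[OF a(1) q(3) differential_tangent[OF prod manifold immersion_smooth v]] Jq
      by simp
    also have "\<dots> = (f b')\<^sup>2 * H y' l (\<zeta> (b', y'))"
      by (simp add: eta_differential[OF q(1,2) v] H_def \<zeta>_def coord_vector_self[OF prod P qP(1)])
    finally show ?thesis .
  qed
  \<comment> \<open>This is \<eta>(\<xi>) = 1 pulled back: the lift has length 1 in the warped
    metric.\<close>
  have unit: "(f b')\<^sup>2 * H y' (\<zeta> (b', y')) (\<zeta> (b', y')) = 1"
    if q: "b' \<in> cdom c" "y' \<in> cdom d" for b' y'
    using eta_differential[OF q xi_lift_tangent] by (simp add: differential_xi_lift eta_xi H_def \<zeta>_def)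

  let ?l = "\<zeta> (b, y)"
  \<comment> \<open>Links the product coordinates to those of N, so that \<open>closed\<close>,
    whose distinguished direction is \<xi>, applies.\<close>
  have DJ_xi: "DJ ?z (0, ?l) = \<xi> ?\<iota> a"
  proof -
    have bP: "(b, y) \<in> cdom P" using b y by simp
    show ?thesis
      using differential_eq[where h = \<iota>, OF prod P bP xi_lift_tangent a
          smooth_map_differentiable[OF immersion_smooth P bP a]]
      by (simp add: DJ_def J_def differential_xi_lift xi_lift_P[OF b y])
  qed
  let ?D2 = "\<lambda>v. frechet_derivative (\<lambda>z. DJ z v) (at ?z)"
  have dJ: "(J has_derivative DJ ?z) (at ?z)"
    unfolding DJ_def using smooth_onD_differentiable[OF J z] has_frechet_derivative by blast
  have dDJ: "((\<lambda>z. DJ z v) has_derivative ?D2 v) (at ?z)" for v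
    using smooth_onD_differentiable[OF smooth_on_frechet_derivative[OF J] z] has_frechet_derivative
    unfolding DJ_def by blast
  have sym: "?D2 v w = ?D2 w v" for v w
    unfolding DJ_def by (rule second_derivative_symmetric[OF S z smooth_on_imp_Ck_on[OF J]])
  \<comment> \<open>\<open>?E v w\<close> is the derivative in direction w of \<alpha> on the
    constant field v. Its last term is symmetric in v and w, so antisymmetrising leaves d\<eta> on
    the images under \<open>DJ ?z\<close>.\<close>
  let ?E = "\<lambda>v w. frechet_derivative (\<lambda>u. eta_coord a u (DJ ?z v)) (at (cmap a ?\<iota>)) (DJ ?z w) +
      eta_coord a (cmap a ?\<iota>) (?D2 v w)"
  have U: "open (cmap a ` cdom a)" "J ?z \<in> cmap a ` cdom a"
    using open_chart_range[OF manifold a(1)] a(2) Jz by auto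
  have pb: "((\<lambda>z. eta_coord a (J z) (DJ z v)) has_derivative ?E v) (at ?z)" for v
    using has_derivative_one_form[OF U eta_coord_linear[OF a(1)]
        eta_coord_differentiable[OF a(1) U(2)] dJ dDJ[of v]] Jz by simp

  \<comment> \<open>\<alpha>(k, 0) is identically 0 on S, hence so is its derivative along the lift
    of \<xi>. Since d\<alpha> vanishes when one argument is that lift, the two slots may be
    exchanged.\<close>
  have E0: "?E (0, ?l) (k, 0) = 0" for k
  proof -
    have "((\<lambda>z. eta_coord a (J z) (DJ z (k, 0))) has_derivative (\<lambda>_. 0)) (at ?z)"
    proof (rule has_derivative_transform_within_open[OF has_derivative_const[of 0] S z])
      fix z assume "z \<in> S"
      then obtain b' y' where q: "b' \<in> cdom c" "y' \<in> cdom d" "\<iota> (b', y') \<in> cdom a"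
        "z = (cmap c b', cmap d y')" unfolding S_def by auto
      have "coord_vector F d y' 0 = 0"
        using coord_vector_linear[OF fibre d q(2), of 0 0 0 0] by simp
      then show "0 = eta_coord a (J z) (DJ z (k, 0))"
        using pullback[OF q(1-3), of k 0] q(4)
          metric_zero_left[OF fibre_metric coord_vector_tangent[OF fibre d q(2)]]
        by (simp add: H_def)
    qed
    from fun_cong[OF has_derivative_unique[OF pb this], of "(0, ?l)"]
    have "?E (k, 0) (0, ?l) = 0" by simp
    then show ?thesis
      using closed[OF a, of "DJ ?z (k, 0)"] sym[of "(k, 0)" "(0, ?l)"] DJ_xi by simp
  qed

  \<comment> \<open>The fibre vector \<open>?l\<close> and the fibre coordinate stay fixed while the
    base point moves; by \<open>E0\<close> the derivative of s at \<open>?x\<close> is 0.\<close>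
  define s where "s x = eta_coord a (J (x, ?y)) (DJ (x, ?y) (0, ?l))" for x
  define h where "h = f \<circ> cinv c"
  have hx: "h (cmap c b') = f b'" if "b' \<in> cdom c" for b'
    using cinv_cmap[OF smooth_manifold_chart[OF base c] that] by (simp add: h_def)
  have "h differentiable (at ?x)"
    using warping_smooth c b unfolding smooth_function_def h_def
    by (intro smooth_onD_differentiable[of "cmap c ` cdom c"]) auto
  note dh = has_frechet_derivative[OF this]
  have ds: "(s has_derivative (\<lambda>k. 0)) (at ?x)"
  proof -
    have "((\<lambda>x. (x, ?y)) has_derivative (\<lambda>k. (k, 0))) (at ?x)"
      by (auto intro!: derivative_eq_intros)
    from has_derivative_compose[OF this pb[of "(0, ?l)"]] show ?thesis
      using E0 by (simp add: s_def[abs_def])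
  qed
  \<comment> \<open>m is nonnegative near \<open>?x\<close> and zero there. Since s is critical with
    value 1, the derivative of m is that of \<open>h\<^sup>2\<close>, and the minimum makes it
    vanish.\<close>
  define m where "m x = (h x)\<^sup>2 - (h ?x)\<^sup>2 * (s x)\<^sup>2" for x
  have Hll: "(f b)\<^sup>2 * H y ?l ?l = 1" by (rule unit[OF b y])
  have sx: "s ?x = 1" using pullback[OF b y a(2), of 0 ?l] Hll by (simp add: s_def)
  have m0: "m ?x = 0" by (simp add: m_def sx)
  have m_pos: "m x \<ge> 0" if xS: "(x, ?y) \<in> S" for x
  proof -
    obtain b' y' where q': "b' \<in> cdom c" "y' \<in> cdom d" "\<iota> (b', y') \<in> cdom a"
        "x = cmap c b'" "?y = cmap d y'" using xS unfolding S_def by auto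
    \<comment> \<open>The second coordinate is unchanged, so both vectors in the coming inequality
      live in the same tangent space of the fibre.\<close>
    have "y' = y"
      using q' y cinv_cmap[OF smooth_manifold_chart[OF fibre d]] by metis
    note q = q'(1-4)[unfolded this]
    let ?L = "\<zeta> (b', y)"
    have cs: "(H y ?l ?L)\<^sup>2 \<le> H y ?l ?l * H y ?L ?L"
      unfolding H_def by (intro metric_cauchy_schwarz[OF fibre fibre_metric] coord_vector_tangent[OF fibre d y])
    \<comment> \<open>s contributes the square of \<open>(f b')\<^sup>2\<close>; the two unit
      conditions then absorb \<open>(f b)\<^sup>2\<close> and one of the two factors
      \<open>(f b')\<^sup>2\<close>.\<close>
    have "(h ?x)\<^sup>2 * (s x)\<^sup>2 = (f b)\<^sup>2 * (f b')\<^sup>2 * (f b')\<^sup>2 * (H y ?l ?L)\<^sup>2"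
      using pullback[OF q(1) y q(3), of 0 ?l] q(4) by (simp add: s_def hx[OF b] power_mult_distrib power2_eq_square)
    also have "\<dots> \<le> (f b)\<^sup>2 * (f b')\<^sup>2 * (f b')\<^sup>2 * (H y ?l ?l * H y ?L ?L)"
      by (intro mult_left_mono cs) simp
    also have "\<dots> = ((f b)\<^sup>2 * H y ?l ?l) * ((f b')\<^sup>2 * H y ?L ?L) * (f b')\<^sup>2"
      by (simp add: ac_simps)
    also have "\<dots> = (h x)\<^sup>2" using Hll unit[OF q(1) y] q(4) hx[OF q(1)] by simp
    finally show ?thesis by (simp add: m_def)
  qed
  have dm: "(m has_derivative (\<lambda>k. 2 * f b * frechet_derivative h (at ?x) k)) (at ?x)"
    unfolding m_def[abs_def]
    by (rule has_derivative_eq_rhs, (rule derivative_intros dh ds)+)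
      (simp add: hx[OF b] fun_eq_iff)
  have "\<forall>\<^sub>F x in at ?x. m ?x \<le> m x"
  proof -
    have "open ((\<lambda>x. (x, ?y)) -` S)"
      by (intro open_vimage S continuous_intros)
    then have "\<forall>\<^sub>F x in at ?x. (x, ?y) \<in> S"
      using eventually_at_in_open'[of "(\<lambda>x. (x, ?y)) -` S" ?x] z by simp
    then show ?thesis by eventually_elim (simp add: m0 m_pos)
  qed
  from has_derivative_local_min[OF dm this]
  have "frechet_derivative h (at ?x) = (\<lambda>_. 0)"
    using warping_pos[of b] by (auto simp: fun_eq_iff)
  then show ?thesis using dh by (simp add: h_def)
qed

end

text \<open>In coordinates f has zero derivative everywhere, hence is constant on balls by
  convexity; connectedness of the base makes the local constancy global.\<close>

lemma warping_constant:
  assumes closed: "\<And>a p e. a \<in> A \<Longrightarrow> p \<in> cdom a \<Longrightarrow>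
      frechet_derivative (\<lambda>u. eta_coord a u e) (at (cmap a p)) (\<xi> p a) =
      frechet_derivative (\<lambda>u. eta_coord a u (\<xi> p a)) (at (cmap a p)) e"
    and conn: "connected (UNIV :: 'b set)"
  shows "f b = f b'"
proof (rule connected_local_const[OF conn])
  show "\<forall>b\<in>UNIV. \<forall>\<^sub>F b' in at b within UNIV. f b = f b'"
  proof
    fix b
    obtain c where c: "c \<in> B" "b \<in> cdom c" using chart_exists[OF base] .
    \<comment> \<open>\<open>undefined\<close> serves as an arbitrary point of the fibre, which
      exists because types are inhabited.\<close>
    obtain d where d: "d \<in> F" "undefined \<in> cdom d" using chart_exists[OF fibre] .
    note ch = smooth_manifold_chart[OF base c(1)]
    have "cmap c b \<in> cmap c ` cdom c" using c(2) by simp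
    then obtain r where r: "r > 0" "ball (cmap c b) r \<subseteq> cmap c ` cdom c"
      using open_chart_range[OF base c(1)] openE by blast
    have "((f \<circ> cinv c) has_derivative (\<lambda>_. 0)) (at x within ball (cmap c b) r)"
      if "x \<in> ball (cmap c b) r" for x
    proof -
      have "x \<in> cmap c ` cdom c" using that r(2) by (rule subsetD[rotated])
      then obtain b' where "b' \<in> cdom c" "x = cmap c b'" by auto
      then show ?thesis
        using has_derivative_at_withinI[OF warping_critical[OF c(1) d(1) closed _ d(2), of b']]
        by simp
    qed
    then have "\<exists>k. \<forall>x\<in>ball (cmap c b) r. (f \<circ> cinv c) x = k"
      by (rule has_derivative_zero_constant[OF convex_ball])
    then obtain k where k: "\<And>x. x \<in> ball (cmap c b) r \<Longrightarrow> (f \<circ> cinv c) x = k" by blast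
    have fk: "f b' = k" if "b' \<in> cdom c" "cmap c b' \<in> ball (cmap c b) r" for b'
      using k[OF that(2)] cinv_cmap[OF ch that(1)] by simp
    have "continuous_on (cdom c) (cmap c)"
      using ch by (simp add: is_chart_def homeomorphism_def)
    then have "open (cmap c -` ball (cmap c b) r \<inter> cdom c)"
      using continuous_on_open_vimage[OF open_cdom[OF base c(1)]] open_ball by blast
    then have "\<forall>\<^sub>F b' in at b. b' \<in> cmap c -` ball (cmap c b) r \<inter> cdom c"
      by (rule eventually_at_in_open') (use c(2) r(1) in simp)
    then show "\<forall>\<^sub>F b' in at b within UNIV. f b = f b'"
      by eventually_elim (use fk c(2) r(1) in auto)
  qed
qed auto

end


theorem theorem9p2:
  fixes A\<^sub>N :: "('n::{t2_space,second_countable_topology}, 'e::euclidean_space) chart set"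
    and A\<^sub>B :: "('b::{t2_space,second_countable_topology}, 'k::euclidean_space) chart set"
    and A\<^sub>F :: "('f::{t2_space,second_countable_topology}, 'l::euclidean_space) chart set"
    and \<phi> :: "'n \<Rightarrow> ('n, 'e) tvec \<Rightarrow> ('n, 'e) tvec"
    and \<xi> :: "('n, 'e) vfield"
    and \<eta> :: "'n \<Rightarrow> ('n, 'e) tvec \<Rightarrow> real"
    and g :: "('n, 'e) metric"
    and nab :: "('n, 'e) connection"
    and g\<^sub>B :: "('b, 'k) metric"
    and g\<^sub>F :: "('f, 'l) metric"
    and f :: "'b \<Rightarrow> real"
    and \<iota> :: "'b \<times> 'f \<Rightarrow> 'n"
  assumes "almost_contact_metric A\<^sub>N \<phi> \<xi> \<eta> g"
    and "levi_civita A\<^sub>N g nab"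
    and "warped_product_submanifold A\<^sub>B g\<^sub>B A\<^sub>F g\<^sub>F f A\<^sub>N g \<iota>"
    and "connected (UNIV :: 'b set)"
    and "\<not> trivial_warping f"
    and "tangent_to_submanifold (prod_atlas A\<^sub>B A\<^sub>F) A\<^sub>N \<iota> \<xi>"
    and "cosymplectic A\<^sub>N \<phi> nab \<or> sasakian A\<^sub>N \<phi> \<xi> \<eta> g nab \<or> kenmotsu A\<^sub>N \<phi> \<xi> \<eta> g nab"
  shows "\<not> (\<exists>D\<^sub>1 D\<^sub>2 \<theta>.
    pointwise_semi_slant (prod_atlas A\<^sub>B A\<^sub>F) A\<^sub>N \<iota> \<phi> g D\<^sub>1 D\<^sub>2 \<theta> \<and> proper_semi_slant \<theta> \<and>
    D\<^sub>1 = fibre_bundle A\<^sub>B A\<^sub>F \<and> D\<^sub>2 = base_bundle A\<^sub>B A\<^sub>F)"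
proof
  assume "\<exists>D\<^sub>1 D\<^sub>2 \<theta>.
    pointwise_semi_slant (prod_atlas A\<^sub>B A\<^sub>F) A\<^sub>N \<iota> \<phi> g D\<^sub>1 D\<^sub>2 \<theta> \<and> proper_semi_slant \<theta> \<and>
    D\<^sub>1 = fibre_bundle A\<^sub>B A\<^sub>F \<and> D\<^sub>2 = base_bundle A\<^sub>B A\<^sub>F"
  then obtain \<theta> where ss: "pointwise_semi_slant (prod_atlas A\<^sub>B A\<^sub>F) A\<^sub>N \<iota> \<phi> g
      (fibre_bundle A\<^sub>B A\<^sub>F) (base_bundle A\<^sub>B A\<^sub>F) \<theta>" and proper: "proper_semi_slant \<theta>"
    by (elim exE conjE) simp
  interpret almost_contact_metric_manifold A\<^sub>N \<phi> \<xi> \<eta> g by unfold_locales (rule assms(1))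
  interpret fibre_tangent_submanifold A\<^sub>N \<phi> \<xi> \<eta> g A\<^sub>B A\<^sub>F \<iota> g\<^sub>B g\<^sub>F f
  proof unfold_locales
    show "smooth_manifold A\<^sub>B" "smooth_manifold A\<^sub>F"
      using assms(3) by (simp_all add: warped_product_submanifold_def riemannian_manifold_def)
    show "smooth_manifold (prod_atlas A\<^sub>B A\<^sub>F)" using ss unfolding pointwise_semi_slant_def by (elim conjE)
    \<comment> \<open>The invariant distribution that contains \<xi> is here the bundle of fibre
      vectors.\<close>
    show "\<exists>v. v \<in> fibre_bundle A\<^sub>B A\<^sub>F p \<and> v \<in> tangent_space (prod_atlas A\<^sub>B A\<^sub>F) p \<and>
      \<xi> (\<iota> p) = differential (prod_atlas A\<^sub>B A\<^sub>F) A\<^sub>N \<iota> p v" for p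
      using xi_in_invariant_distribution[OF ss proper assms(6), of p] by blast
  qed (rule assms(3))
  \<comment> \<open>Each of the three structures makes \<xi> geodesic, so d\<eta>(\<xi>, _) = 0
    holds in every chart of N.\<close>
  have "f b = f b'" for b b'
    by (rule warping_constant[OF eta_coord_closed_xi[OF assms(2) nab_xi_xi[OF assms(2,7)]] assms(4)])
  then show False using assms(5) unfolding trivial_warping_def by blast
qed

end
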